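(* Let $p$ be a prime, let $G$ be a finite group and let $P$ be a Sylow $p$-subgroup of $G$. Then the following two conditions are equivalent: (1) $G$ is $p$-nilpotent. (2) $P$ controls fusion in $G$ of cyclic subgroups of order $p$ in case $p$ is odd, and of cyclic subgroups of order $2$ and $4$ in case $p=2$.
   Context: $G$ is $p$-nilpotent if a Sylow $p$-subgroup $P$ of $G$ has a normal complement in $G$, i.e. there is a normal subgroup $N$ of $G$ with $G=NP$ and $N\cap P=1$. Write $a^g=g^{-1}ag$ and $A^g=g^{-1}Ag$. Let $\mathcal{C}$ be a class of finite $p$-groups; a $\mathcal{C}$-subgroup is a subgroup belonging to $\mathcal{C}$. A subgroup $H$ of $G$ controls fusion of $\mathcal{C}$-groups in $G$ if: (a) any $\mathcal{C}$-subgroup of $G$ is conjugate in $G$ to a subgroup of $H$; and (b) for any $\mathcal{C}$-subgroup $A$ of $G$ and any $g\in G$ such that $A, A^g\leq H$, there exists $x\in H$ such that $a^g=a^x$ for all $a\in A$. Condition (2) is this notion with $H=P$ and $\mathcal{C}$ the class of cyclic groups of order $p$ if $p$ is odd, and the class of cyclic groups of order $2$ or $4$ if $p=2$. *)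

theory Defs
  imports "HOL-Algebra.Algebra"
begin

definition sylow_subgroup :: "nat \<Rightarrow> 'a set \<Rightarrow> ('a, 'b) monoid_scheme \<Rightarrow> bool" where
  "sylow_subgroup p P G \<longleftrightarrow> subgroup P G \<and> card P = p ^ multiplicity p (order G)"

definition p_nilpotent :: "nat \<Rightarrow> ('a, 'b) monoid_scheme \<Rightarrow> bool" where
  "p_nilpotent p G \<longleftrightarrow>
     (\<exists>P N. sylow_subgroup p P G \<and> N \<lhd> G \<and>
            carrier G = N <#>\<^bsub>G\<^esub> P \<and> N \<inter> P = {\<one>\<^bsub>G\<^esub>})"

definition conj_elt :: "('a, 'b) monoid_scheme \<Rightarrow> 'a \<Rightarrow> 'a \<Rightarrow> 'a" where
  "conj_elt G a g = inv\<^bsub>G\<^esub> g \<otimes>\<^bsub>G\<^esub> a \<otimes>\<^bsub>G\<^esub> g"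

definition conj_set :: "('a, 'b) monoid_scheme \<Rightarrow> 'a set \<Rightarrow> 'a \<Rightarrow> 'a set" where
  "conj_set G A g = (inv\<^bsub>G\<^esub> g <#\<^bsub>G\<^esub> A) #>\<^bsub>G\<^esub> g"

text \<open>A class of groups is a predicate on group structures; a subgroup belongs to the
  class if the group structure it inherits does.\<close>

definition class_subgroup ::
    "(('a, 'b) monoid_scheme \<Rightarrow> bool) \<Rightarrow> 'a set \<Rightarrow> ('a, 'b) monoid_scheme \<Rightarrow> bool" where
  "class_subgroup \<C> A G \<longleftrightarrow> subgroup A G \<and> \<C> (G\<lparr>carrier := A\<rparr>)"

definition controls_fusion ::
    "(('a, 'b) monoid_scheme \<Rightarrow> bool) \<Rightarrow> 'a set \<Rightarrow> ('a, 'b) monoid_scheme \<Rightarrow> bool" where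
  "controls_fusion \<C> H G \<longleftrightarrow>
     subgroup H G \<and>
     (\<forall>A. class_subgroup \<C> A G \<longrightarrow> (\<exists>g\<in>carrier G. conj_set G A g \<subseteq> H)) \<and>
     (\<forall>A. \<forall>g\<in>carrier G.
        class_subgroup \<C> A G \<and> A \<subseteq> H \<and> conj_set G A g \<subseteq> H \<longrightarrow>
        (\<exists>x\<in>H. \<forall>a\<in>A. conj_elt G a g = conj_elt G a x))"

definition small_cyclic_class :: "nat \<Rightarrow> ('a, 'b) monoid_scheme \<Rightarrow> bool" where
  "small_cyclic_class p K \<longleftrightarrow>
     group K \<and> cyclic_group K \<and> (if p = 2 then order K = 2 \<or> order K = 4 else order K = p)"

end

theory Submission
  imports Defs "HOL-Number_Theory.Cong"
begin

text \<open>
  Conjugation \<open>a\<^sup>g = g\<inverse>ag\<close> is denoted by a bold caret in formal text. An element is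
  \<^emph>\<open>p-regular\<close> if its order is prime to \<open>p\<close>.

  A normal complement \<open>N\<close> of \<open>P\<close> makes fusion in \<open>P\<close> trivial: writing \<open>g = xm\<close> with \<open>x \<in> P\<close> and
  \<open>m \<in> N\<close>, the conjugates of \<open>a \<in> P\<close> by \<open>g\<close> and by \<open>x\<close> agree modulo \<open>N\<close>, so they are equal as soon as both
  lie in \<open>P\<close>. This is \<open>controls_fusion_if_p_nilpotent\<close>.

  The converse goes through Frobenius' criterion \<open>frobenius_p_nilpotency_criterion\<close>: if every
  p-regular element that normalizes a p-subgroup centralizes it, then the p-regular elements form a
  subgroup, and this subgroup is the normal complement.

  The hypothesis of the criterion follows from fusion of small cyclic subgroups by
  \<open>p_regular_centralizes_if_small_fusion\<close>. Let a p-regular \<open>g\<close> normalize \<open>Q \<le> P\<close>. In a minimal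
  counterexample \<open>g\<close> centralizes all proper \<open>g\<close>-invariant subgroups of \<open>Q\<close>, and this forces
  \<open>a\<^sup>p = 1\<close> for all \<open>a \<in> Q\<close>, or \<open>a\<^sup>4 = 1\<close> if \<open>p = 2\<close> (\<open>exponent_of_minimal_action\<close>). So the fusion
  hypothesis speaks of all elements of \<open>Q\<close>: \<open>g\<close> moves each of them as some element of \<open>P\<close> does. Elements of
  \<open>P\<close> act trivially on the factors of a central series of \<open>P\<close>; hence \<open>g\<close> acts trivially on the factors of
  the induced series of \<open>Q\<close>, and a p-regular automorphism of a p-group with this property is trivial.

  The criterion itself is proved by induction on the order of \<open>G\<close>. Its hypothesis implies that \<open>P\<close> controls fusion
  of all its subgroups (\<open>sylow_controls_fusion\<close>). The transfer from \<open>G\<close> into a quotient of order \<open>p\<close> of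
  \<open>P\<close> can then be evaluated and is not trivial (\<open>transfer_nontrivial\<close>); its kernel is a proper
  subgroup that contains all p-regular elements of \<open>G\<close>.
\<close>

section \<open>Conjugation and subgroups\<close>

context group
begin

abbreviation conj_by :: "'a \<Rightarrow> 'a \<Rightarrow> 'a" (infixl \<open>\<^bold>^\<close> 75)
  where "a \<^bold>^ g \<equiv> conj_elt G a g"

lemma inv_cancel_left [simp]:
  "\<lbrakk>x \<in> carrier G; y \<in> carrier G\<rbrakk> \<Longrightarrow> inv x \<otimes> (x \<otimes> y) = y"
  "\<lbrakk>x \<in> carrier G; y \<in> carrier G\<rbrakk> \<Longrightarrow> x \<otimes> (inv x \<otimes> y) = y"
  by (simp_all flip: m_assoc)

lemma conj_closed [simp]: "\<lbrakk>a \<in> carrier G; g \<in> carrier G\<rbrakk> \<Longrightarrow> a \<^bold>^ g \<in> carrier G"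
  by (simp add: conj_elt_def)

lemma conj_mult:
  "\<lbrakk>a \<in> carrier G; b \<in> carrier G; g \<in> carrier G\<rbrakk> \<Longrightarrow> (a \<otimes> b) \<^bold>^ g = a \<^bold>^ g \<otimes> b \<^bold>^ g"
  by (simp add: conj_elt_def m_assoc)

lemma conj_conj:
  "\<lbrakk>a \<in> carrier G; g \<in> carrier G; h \<in> carrier G\<rbrakk> \<Longrightarrow> a \<^bold>^ g \<^bold>^ h = a \<^bold>^ (g \<otimes> h)"
  by (simp add: conj_elt_def m_assoc inv_mult_group)

lemma conj_inv:
  "\<lbrakk>a \<in> carrier G; g \<in> carrier G\<rbrakk> \<Longrightarrow> (inv a) \<^bold>^ g = inv (a \<^bold>^ g)"
  by (simp add: conj_elt_def m_assoc inv_mult_group)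

lemma one_conj [simp]: "g \<in> carrier G \<Longrightarrow> \<one> \<^bold>^ g = \<one>"
  by (simp add: conj_elt_def)

lemma conj_one [simp]: "a \<in> carrier G \<Longrightarrow> a \<^bold>^ \<one> = a"
  by (simp add: conj_elt_def)

lemma conj_conj_inv [simp]:
  "\<lbrakk>a \<in> carrier G; g \<in> carrier G\<rbrakk> \<Longrightarrow> a \<^bold>^ g \<^bold>^ (inv g) = a"
  "\<lbrakk>a \<in> carrier G; g \<in> carrier G\<rbrakk> \<Longrightarrow> a \<^bold>^ (inv g) \<^bold>^ g = a"
  by (simp_all add: conj_conj)

lemma conj_pow:
  assumes "a \<in> carrier G" "g \<in> carrier G"
  shows "(a [^] (n::nat)) \<^bold>^ g = (a \<^bold>^ g) [^] n"
  by (induction n) (use assms in \<open>simp_all add: conj_mult\<close>)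

lemma conj_int_pow:
  assumes "a \<in> carrier G" "g \<in> carrier G"
  shows "(a [^] (n::int)) \<^bold>^ g = (a \<^bold>^ g) [^] n"
  by (cases n rule: int_cases2)
     (use assms in \<open>simp_all add: int_pow_int int_pow_neg conj_pow conj_inv\<close>)

lemma conj_cancel:
  "\<lbrakk>a \<in> carrier G; b \<in> carrier G; g \<in> carrier G\<rbrakk> \<Longrightarrow> a \<^bold>^ g = b \<^bold>^ g \<longleftrightarrow> a = b"
  by (metis conj_conj_inv(1))

lemma conj_inj_on: "g \<in> carrier G \<Longrightarrow> A \<subseteq> carrier G \<Longrightarrow> inj_on (\<lambda>a. a \<^bold>^ g) A"
  by (auto simp: inj_on_def conj_cancel subset_iff)

lemma conj_eq_iff:
  "\<lbrakk>a \<in> carrier G; b \<in> carrier G; g \<in> carrier G\<rbrakk> \<Longrightarrow> a \<^bold>^ g = b \<longleftrightarrow> a \<otimes> g = g \<otimes> b"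
  by (auto simp: conj_elt_def m_assoc)

lemma conj_fix_iff:
  "\<lbrakk>a \<in> carrier G; g \<in> carrier G\<rbrakk> \<Longrightarrow> a \<^bold>^ g = a \<longleftrightarrow> a \<otimes> g = g \<otimes> a"
  by (auto simp: conj_eq_iff)

lemma conj_set_image:
  "\<lbrakk>A \<subseteq> carrier G; g \<in> carrier G\<rbrakk> \<Longrightarrow> conj_set G A g = (\<lambda>a. a \<^bold>^ g) ` A"
  by (auto simp: conj_set_def conj_elt_def r_coset_def l_coset_def)

lemma ord_conj:
  assumes "x \<in> carrier G" "g \<in> carrier G"
  shows "ord (x \<^bold>^ g) = ord x"
proof -
  have "(x \<^bold>^ g) [^] n = \<one> \<longleftrightarrow> x [^] n = \<one>" for n :: nat
    using conj_pow[OF assms, of n] conj_cancel[of "x [^] n" \<one> g] assms by simp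
  then show ?thesis using ord_unique[of "x \<^bold>^ g" "ord x"] assms by (simp add: pow_eq_id)
qed

lemma subgroup_conj:
  assumes "subgroup A G" "g \<in> carrier G"
  shows "subgroup ((\<lambda>a. a \<^bold>^ g) ` A) G"
proof -
  interpret A: subgroup A G by fact
  show ?thesis
  proof (rule subgroupI)
    show "(\<lambda>a. a \<^bold>^ g) ` A \<subseteq> carrier G" using assms(2) by auto
    show "(\<lambda>a. a \<^bold>^ g) ` A \<noteq> {}" using A.one_closed by blast
    show "inv x \<in> (\<lambda>a. a \<^bold>^ g) ` A" if "x \<in> (\<lambda>a. a \<^bold>^ g) ` A" for x
      using that assms(2) by (auto simp flip: conj_inv)
    show "x \<otimes> y \<in> (\<lambda>a. a \<^bold>^ g) ` A"
      if "x \<in> (\<lambda>a. a \<^bold>^ g) ` A" "y \<in> (\<lambda>a. a \<^bold>^ g) ` A" for x y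
      using that assms(2) by (auto simp flip: conj_mult)
  qed
qed

lemma subgroup_nat_pow_closed:
  assumes "subgroup H G" "x \<in> H"
  shows "x [^] (n::nat) \<in> H"
  by (induction n) (use assms in \<open>auto simp: subgroup.one_closed subgroup.m_closed\<close>)

lemma subgroup_int_pow_closed:
  assumes "subgroup H G" "x \<in> H"
  shows "x [^] (n::int) \<in> H"
  by (cases n rule: int_cases2)
     (use assms in \<open>auto simp: int_pow_int int_pow_neg subgroup.mem_carrier
       subgroup.m_inv_closed subgroup_nat_pow_closed\<close>)

lemma conj_elt_subgroup:
  "\<lbrakk>subgroup K G; g \<in> K\<rbrakk> \<Longrightarrow> conj_elt (G\<lparr>carrier := K\<rparr>) a g = a \<^bold>^ g"
  by (simp add: conj_elt_def)

lemma ord_subgroup: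
  assumes "subgroup K G" "x \<in> K"
  shows "group.ord (G\<lparr>carrier := K\<rparr>) x = ord x"
proof -
  interpret K: group "G\<lparr>carrier := K\<rparr>"
    using assms(1) by (rule subgroup_imp_group)
  have "x \<in> carrier G" using assms subgroup.mem_carrier by metis
  then show ?thesis
    using K.ord_unique[of x "ord x"] assms by (simp add: pow_eq_id flip: nat_pow_consistent)
qed

lemma subgroup_restrict_iff:
  assumes "subgroup K G"
  shows "subgroup H (G\<lparr>carrier := K\<rparr>) \<longleftrightarrow> subgroup H G \<and> H \<subseteq> K"
proof
  assume H: "subgroup H (G\<lparr>carrier := K\<rparr>)"
  then have "H \<subseteq> K" using subgroup.subset by fastforce
  then show "subgroup H G \<and> H \<subseteq> K" using incl_subgroup[OF assms H] by simp
qed (use assms subgroup_incl in blast)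

lemma dvd_card_subgroup:
  assumes "finite (carrier G)" "subgroup H G" "subgroup K G" "H \<subseteq> K"
  shows "card H dvd card K"
proof -
  interpret K: group "G\<lparr>carrier := K\<rparr>"
    using assms(3) by (rule subgroup_imp_group)
  have "subgroup H (G\<lparr>carrier := K\<rparr>)" using assms by (simp add: subgroup_restrict_iff)
  from K.lagrange[OF this] show ?thesis
    by (simp add: order_def) (metis dvd_triv_right)
qed

lemma ord_dvd_card_subgroup:
  assumes "finite (carrier G)" "subgroup H G" "x \<in> H"
  shows "ord x dvd card H"
proof -
  interpret H: group "G\<lparr>carrier := H\<rparr>"
    using assms(2) by (rule subgroup_imp_group)
  show ?thesis
    using H.ord_dvd_group_order[of x] assms ord_subgroup[of H x] by (simp add: order_def)
qed

lemma subgroup_finite: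
  assumes "finite (carrier G)" "subgroup H G"
  shows "finite H"
  using assms subgroup.subset finite_subset by metis

lemma card_rcosets_eq_div:
  assumes "finite (carrier G)" "subgroup H G"
  shows "card (rcosets H) = order G div card H"
proof -
  have "card H > 0" using assms by (simp add: subgroup.finite_imp_card_positive)
  then show ?thesis using lagrange[OF assms(2)] by (metis less_not_refl nonzero_mult_div_cancel_right)
qed

lemma finite_rcosets:
  assumes "finite (carrier G)" "subgroup H G"
  shows "finite (rcosets H)"
  using assms by (metis finite_UnionD rcosets_part_G)

lemma rcoset_translate:
  assumes "subgroup H G" "C \<in> rcosets H" "g \<in> carrier G"
  shows "C #> g \<in> rcosets H"
  using assms by (auto simp: RCOSETS_def coset_mult_assoc subgroup.subset)

lemma rcosets_subset_carrier:
  "\<lbrakk>subgroup H G; C \<in> rcosets H\<rbrakk> \<Longrightarrow> C \<subseteq> carrier G"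
  by (simp add: subgroup.rcosets_carrier)

lemma rcoset_quotient:
  assumes "subgroup H G" "C \<in> rcosets H" "x \<in> C" "y \<in> C"
  shows "x \<otimes> inv y \<in> H"
proof -
  interpret H: subgroup H G by fact
  obtain a where a: "a \<in> carrier G" "C = H #> a" using assms(2) by (auto simp: RCOSETS_def)
  obtain h k where "h \<in> H" "k \<in> H" "x = h \<otimes> a" "y = k \<otimes> a"
    using assms(3,4) a(2) by (auto simp: r_coset_def)
  then show ?thesis using a(1) by (simp add: inv_mult_group m_assoc)
qed

lemma rcoset_fixed_iff:
  assumes H: "subgroup H G" and "x \<in> carrier G" "r \<in> carrier G"
  shows "H #> x #> r = H #> x \<longleftrightarrow> x \<otimes> r \<otimes> inv x \<in> H"
proof -
  have "H #> x #> r = H #> x \<longleftrightarrow> H #> (x \<otimes> r) #> inv x = H"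
    using assms by (metis coset_mult_assoc coset_mult_inv1 coset_mult_inv2 inv_closed m_closed subgroup.subset)
  also have "H #> (x \<otimes> r) #> inv x = H #> (x \<otimes> r \<otimes> inv x)"
    using assms by (simp add: coset_mult_assoc subgroup.subset)
  also have "\<dots> = H \<longleftrightarrow> x \<otimes> r \<otimes> inv x \<in> H"
    using assms by (meson coset_join1 coset_join2 inv_closed m_closed subgroup.subset)
  finally show ?thesis .
qed

lemma normalizer_in_subgroup:
  assumes "subgroup P G" "subgroup A G" "A \<subseteq> P"
  shows "subgroup {x \<in> P. (\<lambda>a. a \<^bold>^ x) ` A = A} G"
proof -
  interpret P: subgroup P G by fact
  interpret A: subgroup A G by fact
  have comp: "(\<lambda>a. a \<^bold>^ (x \<otimes> y)) ` A = (\<lambda>a. a \<^bold>^ y) ` ((\<lambda>a. a \<^bold>^ x) ` A)"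
    if "x \<in> P" "y \<in> P" for x y
    using that by (auto simp: image_image conj_conj)
  show ?thesis
  proof (rule subgroupI)
    show "inv x \<in> {x \<in> P. (\<lambda>a. a \<^bold>^ x) ` A = A}" if x: "x \<in> {x \<in> P. (\<lambda>a. a \<^bold>^ x) ` A = A}" for x
    proof -
      have xG: "x \<in> carrier G" using x by simp
      have "(\<lambda>a. a \<^bold>^ (inv x)) ` A = (\<lambda>a. a \<^bold>^ (inv x)) ` ((\<lambda>a. a \<^bold>^ x) ` A)" using x by simp
      also have "\<dots> = A" using xG by (simp add: image_image)
      finally show ?thesis using x by simp
    qed
  qed (use comp in \<open>auto simp: P.one_closed intro!: exI[of _ \<one>]\<close>)
qed

lemma mult_powers_subgroup:
  assumes M: "subgroup M G" and z: "z \<in> carrier G" and norm: "\<And>m. m \<in> M \<Longrightarrow> m \<^bold>^ z \<in> M"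
    "\<And>m. m \<in> M \<Longrightarrow> m \<^bold>^ (inv z) \<in> M"
  shows "subgroup {m \<otimes> z [^] (i::int) | m i. m \<in> M} G"
proof -
  interpret M: subgroup M G by fact
  have nat: "m \<^bold>^ (z [^] (n::nat)) \<in> M" "m \<^bold>^ (inv z [^] n) \<in> M" if "m \<in> M" for m n
  proof (induction n)
    case (Suc n)
    case 1
    then show ?case using Suc norm(1)[OF Suc(1)] that z by (simp add: conj_conj)
  next
    case (Suc n)
    case 2
    then show ?case using Suc norm(2)[OF Suc(2)] that z by (simp add: conj_conj)
  qed (use that in auto)
  have int: "m \<^bold>^ (z [^] (i::int)) \<in> M" if "m \<in> M" for m i
    by (cases i rule: int_cases2) (use nat[OF that] z in \<open>simp_all add: int_pow_int int_pow_neg nat_pow_inv\<close>)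
  have swap: "z [^] i \<otimes> m = m \<^bold>^ (z [^] (- i)) \<otimes> z [^] i" if "m \<in> M" for m and i :: int
    using that z by (simp add: conj_elt_def int_pow_neg m_assoc)
  show ?thesis
  proof (rule subgroupI)
    show "inv x \<in> {m \<otimes> z [^] (i::int) | m i. m \<in> M}"
      if x: "x \<in> {m \<otimes> z [^] (i::int) | m i. m \<in> M}" for x
    proof -
      obtain m i where mi: "m \<in> M" "x = m \<otimes> z [^] (i::int)" using x by blast
      have "inv x = z [^] (- i) \<otimes> inv m"
        unfolding mi(2) using mi(1) z by (simp add: inv_mult_group int_pow_neg)
      also have "\<dots> = (inv m) \<^bold>^ (z [^] i) \<otimes> z [^] (- i)"
        using swap[of "inv m" "- i"] mi(1) by simp
      finally show ?thesis using int mi(1) M.m_inv_closed by blast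
    qed
    show "x \<otimes> y \<in> {m \<otimes> z [^] (i::int) | m i. m \<in> M}"
      if xy: "x \<in> {m \<otimes> z [^] (i::int) | m i. m \<in> M}" "y \<in> {m \<otimes> z [^] (i::int) | m i. m \<in> M}" for x y
    proof -
      obtain m i n j where mi: "m \<in> M" "x = m \<otimes> z [^] (i::int)" "n \<in> M" "y = n \<otimes> z [^] (j::int)"
        using xy by blast
      have "x \<otimes> y = m \<otimes> (z [^] i \<otimes> n) \<otimes> z [^] j"
        unfolding mi(2,4) using mi(1,3) z by (simp add: m_assoc)
      also have "z [^] i \<otimes> n = n \<^bold>^ (z [^] (- i)) \<otimes> z [^] i" using mi(3) by (rule swap)
      also have "m \<otimes> (n \<^bold>^ (z [^] (- i)) \<otimes> z [^] i) \<otimes> z [^] j =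
          (m \<otimes> n \<^bold>^ (z [^] (- i))) \<otimes> z [^] (i + j)"
        using mi(1,3) z by (simp add: m_assoc int_pow_mult)
      finally show ?thesis using int mi(1,3) M.m_closed by blast
    qed
    show "{m \<otimes> z [^] (i::int) | m i. m \<in> M} \<noteq> {}" using M.one_closed by blast
  qed (use z in auto)
qed

end

locale finite_group_at_prime = group G for G (structure) +
  fixes p :: nat
  assumes finite_carrier [simp]: "finite (carrier G)"
    and prime_p: "Factorial_Ring.prime p"

definition p_subgroup :: "nat \<Rightarrow> 'a set \<Rightarrow> ('a, 'b) monoid_scheme \<Rightarrow> bool" where
  "p_subgroup p Q G \<longleftrightarrow> subgroup Q G \<and> (\<exists>k. card Q = p ^ k)"

context finite_group_at_prime
begin

lemma subgroup_at_prime: "subgroup H G \<Longrightarrow> finite_group_at_prime (G\<lparr>carrier := H\<rparr>) p"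
  by (auto simp: finite_group_at_prime_def finite_group_at_prime_axioms_def prime_p
      subgroup_imp_group subgroup_finite)

lemma ord_coprime_imp_trivial:
  assumes "x \<in> carrier G" "coprime (ord x) p" "x [^] (p ^ k) = \<one>"
  shows "x = \<one>"
proof -
  have "ord x dvd p ^ k" using assms pow_eq_id by blast
  moreover have "coprime (ord x) (p ^ k)" using assms(2) by simp
  ultimately have "ord x = 1" using coprime_common_divisor[of "ord x" "p ^ k" "ord x"] by simp
  then show ?thesis using assms(1) ord_eq_1 by blast
qed

lemma p_subgroup_pow:
  assumes "p_subgroup p Q G"
  obtains k where "\<And>x. x \<in> Q \<Longrightarrow> x [^] (p ^ k) = \<one>"
proof -
  obtain k where Q: "subgroup Q G" and k: "card Q = p ^ k"
    using assms by (auto simp: p_subgroup_def)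
  have "x [^] (p ^ k) = \<one>" if "x \<in> Q" for x
    using ord_dvd_card_subgroup[OF finite_carrier Q that] that Q k pow_eq_id subgroup.mem_carrier
    by metis
  then show ?thesis using that by blast
qed

lemma p_subgroup_mono:
  assumes "p_subgroup p Q G" "subgroup R G" "R \<subseteq> Q"
  shows "p_subgroup p R G"
  using assms prime_p dvd_card_subgroup[of R Q] divides_primepow_nat
  by (auto simp: p_subgroup_def)

lemma p_subgroup_conj:
  assumes "p_subgroup p Q G" "g \<in> carrier G"
  shows "p_subgroup p ((\<lambda>a. a \<^bold>^ g) ` Q) G"
  using assms by (auto simp: p_subgroup_def subgroup_conj card_image conj_inj_on subgroup.subset)

lemma conj_image_eq_self:
  assumes A: "subgroup A G" and g: "g \<in> carrier G" and "\<And>a. a \<in> A \<Longrightarrow> a \<^bold>^ g \<in> A"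
  shows "(\<lambda>a. a \<^bold>^ g) ` A = A"
  using assms by (intro endo_inj_surj) (auto simp: subgroup_finite conj_inj_on subgroup.subset)

end

section \<open>Fixed points of actions of p-groups\<close>

text \<open>The orbit of a point that is not fixed has as length a power of \<open>p\<close> other than \<open>1\<close>, so the
  points that are not fixed are partitioned into sets whose sizes are multiples of \<open>p\<close>.\<close>

lemma p_power_action_fixed_points:
  fixes R (structure)
  assumes p: "Factorial_Ring.prime p" and R: "group R" and cR: "card (carrier R) = p ^ k"
    and E: "finite E"
    and closed: "\<And>g x. g \<in> carrier R \<Longrightarrow> x \<in> E \<Longrightarrow> act g x \<in> E"
    and one: "\<And>x. x \<in> E \<Longrightarrow> act \<one> x = x"
    and mult: "\<And>g h x. g \<in> carrier R \<Longrightarrow> h \<in> carrier R \<Longrightarrow> x \<in> E \<Longrightarrow>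
                 act (g \<otimes> h) x = act g (act h x)"
  shows "[card E = card {x \<in> E. \<forall>g\<in>carrier R. act g x = x}] (mod p)"
proof -
  interpret R: group R by fact
  define \<phi> where "\<phi> g = restrict (act g) E" for g
  have inv1: "act (inv g) (act g x) = x" "act g (act (inv g) x) = x"
    if "g \<in> carrier R" "x \<in> E" for g x
    using that one by (simp_all flip: mult)
  have bij: "\<phi> g \<in> Bij E" if "g \<in> carrier R" for g
  proof -
    have "bij_betw (act g) E E"
      by (rule bij_betw_byWitness[where f' = "act (inv g)"]) (use that closed inv1 in auto)
    then show ?thesis unfolding \<phi>_def Bij_def by (auto cong: bij_betw_cong)
  qed
  interpret group_action R E \<phi>
  proof (rule group_action.intro)
    have "\<phi> (g \<otimes> h) = compose E (\<phi> g) (\<phi> h)" if "g \<in> carrier R" "h \<in> carrier R" for g h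
      using that closed by (auto simp: \<phi>_def compose_def mult fun_eq_iff)
    then show "group_hom R (BijGroup E) \<phi>"
      unfolding group_hom_def group_hom_axioms_def hom_def
      using bij group_BijGroup[of E] R by (auto simp: BijGroup_def)
  qed
  define F where "F = {x \<in> E. \<forall>g\<in>carrier R. act g x = x}"
  define C where "C = {orb \<in> orbits R E \<phi>. \<not> orb \<subseteq> F}"
  have orb: "orbit R \<phi> x = (\<lambda>g. act g x) ` carrier R" if "x \<in> E" for x
    using that by (auto simp: orbit_def \<phi>_def)
  have fixed: "x \<in> F \<longleftrightarrow> orbit R \<phi> x = {x}" if "x \<in> E" for x
    using that one by (auto simp: F_def orb intro: rev_image_eqI[OF R.one_closed])
  have disj: "c1 = c2 \<or> c1 \<inter> c2 = {}" if "c1 \<in> C" "c2 \<in> C" for c1 c2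
    using that disjoint_union by (auto simp: C_def)
  have UC: "\<Union>C = E - F"
  proof (intro equalityI subsetI)
    fix y assume "y \<in> \<Union>C"
    then obtain x where x: "x \<in> E" "y \<in> orbit R \<phi> x" "\<not> orbit R \<phi> x \<subseteq> F"
      by (auto simp: C_def orbits_def)
    have yX: "y \<in> E" using x closed by (auto simp: orb)
    have "y \<notin> F"
    proof
      assume yF: "y \<in> F"
      then have "orbit R \<phi> y = {y}" using fixed yX by blast
      moreover have "x \<in> orbit R \<phi> y" using orbit_sym[OF x(1) yX x(2)] .
      ultimately have "x = y" by simp
      then show False using x(3) yF \<open>orbit R \<phi> y = {y}\<close> by simp
    qed
    then show "y \<in> E - F" using yX by simp
  next
    fix y assume y: "y \<in> E - F"
    then have "y \<in> orbit R \<phi> y" using orbit_refl by auto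
    then show "y \<in> \<Union>C" using y by (auto simp: C_def orbits_def)
  qed
  have "p dvd card c" if c: "c \<in> C" for c
  proof -
    obtain x where x: "x \<in> E" "c = orbit R \<phi> x" using c by (auto simp: C_def orbits_def)
    have "card c * card (stabilizer R \<phi> x) = p ^ k"
      using orbit_stabilizer_theorem[OF x(1)] x(2) cR by (simp add: order_def)
    then have "card c dvd p ^ k" by (metis dvd_triv_left)
    then obtain j where j: "card c = p ^ j" using p divides_primepow_nat by blast
    have "card c \<noteq> 1"
    proof
      assume "card c = 1"
      moreover have "x \<in> c" using x orbit_refl by simp
      ultimately have "c = {x}" by (metis card_1_singletonE singletonD)
      then have "x \<in> F" using fixed x by blast
      then have "c \<subseteq> F" using \<open>c = {x}\<close> by simp
      then show False using c by (simp add: C_def)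
    qed
    then show ?thesis using j by (cases j) auto
  qed
  then have "p dvd card (\<Union>C)"
    using dvd_partition[of C p] disj UC E by auto
  then have "p dvd card E - card F"
    using UC E by (simp add: F_def card_Diff_subset)
  moreover have "card F \<le> card E" using E by (auto simp: F_def intro: card_mono)
  ultimately show ?thesis
    unfolding F_def[symmetric] using cong_altdef_nat cong_sym by (metis (mono_tags))
qed

context finite_group_at_prime
begin

text \<open>The common source of three results: Sylow's conjugacy theorem (\<open>H\<close> a Sylow subgroup), growth of
  normalizers (\<open>H = R\<close>) and the evaluation of the transfer at an element of \<open>P\<close> (\<open>R\<close> cyclic, \<open>H = P\<close>).\<close>

lemma fixed_cosets_cong:
  assumes H: "subgroup H G" and R: "p_subgroup p R G"
  shows "[card (rcosets H) = card {C \<in> rcosets H. \<forall>r\<in>R. C #> r = C}] (mod p)"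
proof -
  have RG: "subgroup R G" and "\<exists>k. card R = p ^ k" using R by (auto simp: p_subgroup_def)
  then obtain k where k: "card R = p ^ k" by blast
  interpret R: subgroup R G by fact
  interpret RR: group "G\<lparr>carrier := R\<rparr>" using RG by (rule subgroup_imp_group)
  have sub: "C \<subseteq> carrier G" if "C \<in> rcosets H" for C
    using that H by (simp add: group.rcosets_subset_PowG subgroup.rcosets_carrier)
  have cl: "C #> g \<in> rcosets H" if "C \<in> rcosets H" "g \<in> carrier G" for C g
    using that H by (auto simp: RCOSETS_def coset_mult_assoc subgroup.subset)
  have "[card (rcosets H) = card {C \<in> rcosets H. \<forall>g\<in>carrier (G\<lparr>carrier := R\<rparr>). C #> inv g = C}] (mod p)"
  proof (rule p_power_action_fixed_points)
    show "finite (rcosets H)" using H by (simp add: finite_rcosets)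
  qed (use prime_p k sub cl in \<open>simp_all add: RR.is_group coset_mult_assoc inv_mult_group\<close>)
  also have "{C \<in> rcosets H. \<forall>g\<in>carrier (G\<lparr>carrier := R\<rparr>). C #> inv g = C} =
      {C \<in> rcosets H. \<forall>r\<in>R. C #> r = C}"
  proof -
    have "(\<forall>g\<in>R. C #> inv g = C) \<longleftrightarrow> (\<forall>r\<in>R. C #> r = C)" for C
      using R.m_inv_closed R.mem_carrier by (metis inv_inv)
    then show ?thesis by simp
  qed
  finally show ?thesis .
qed

text \<open>The number of cosets of \<open>S\<close> is prime to \<open>p\<close>, hence \<open>R\<close> fixes some coset \<open>Sx\<close>, which means
  \<open>xRx\<inverse> \<subseteq> S\<close>.\<close>

lemma sylow_conjugate:
  assumes S: "subgroup S G" "\<not> p dvd card (rcosets S)" and R: "p_subgroup p R G"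
  shows "\<exists>x\<in>carrier G. \<forall>r\<in>R. r \<^bold>^ x \<in> S"
proof -
  let ?F = "{C \<in> rcosets S. \<forall>r\<in>R. C #> r = C}"
  have RG: "R \<subseteq> carrier G" using R by (auto simp: p_subgroup_def subgroup.subset)
  have "\<not> p dvd card ?F"
    using fixed_cosets_cong[OF S(1) R] S(2) by (simp add: cong_dvd_iff)
  then have "?F \<noteq> {}" by (metis card.empty dvd_0_right)
  then obtain x where x: "x \<in> carrier G" "\<forall>r\<in>R. S #> x #> r = S #> x"
    by (auto simp: RCOSETS_def)
  then have "\<forall>r\<in>R. r \<^bold>^ (inv x) \<in> S"
    using rcoset_fixed_iff[OF S(1)] RG by (auto simp: conj_elt_def subset_iff)
  then show ?thesis using x by blast
qed

lemma sylow_conjugate_within: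
  assumes N: "subgroup N G" and S: "subgroup S G" "S \<subseteq> N" "\<not> p dvd card N div card S"
    and R: "p_subgroup p R G" "R \<subseteq> N"
  shows "\<exists>x\<in>N. \<forall>r\<in>R. r \<^bold>^ x \<in> S"
proof -
  interpret N: finite_group_at_prime "G\<lparr>carrier := N\<rparr>" p using N by (rule subgroup_at_prime)
  have S': "subgroup S (G\<lparr>carrier := N\<rparr>)" using N S by (simp add: subgroup_restrict_iff)
  have "\<not> p dvd card (rcosets\<^bsub>G\<lparr>carrier := N\<rparr>\<^esub> S)"
    using S(3) N.card_rcosets_eq_div[OF N.finite_carrier S'] by (simp add: order_def)
  from N.sylow_conjugate[OF S' this, of R] show ?thesis
    using R N by (auto simp: p_subgroup_def subgroup_restrict_iff conj_elt_subgroup)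
qed

lemma prime_dvd_proper_index:
  assumes "p_subgroup p P G" "subgroup A G" "A \<subset> P"
  shows "p dvd card P div card A"
proof -
  obtain k where k: "card P = p ^ k" and P: "subgroup P G" using assms by (auto simp: p_subgroup_def)
  have "finite P" using P by (simp add: subgroup_finite)
  then have lt: "card A < card P" using assms(3) by (simp add: psubset_card_mono)
  have "card A dvd card P" using assms P by (auto intro: dvd_card_subgroup)
  then obtain d where d: "card P = card A * d" by blast
  then have "d \<noteq> 1" using lt by auto
  moreover obtain j where "d = p ^ j"
    using d k prime_p divides_primepow_nat by (metis dvd_triv_right)
  ultimately have "p dvd d" by (cases j) auto
  moreover have "card A > 0" using assms(2) by (simp add: subgroup.finite_imp_card_positive)
  ultimately show ?thesis using d by simp
qed

text \<open>In its action on the cosets of \<open>A\<close> in \<open>P\<close>, the group \<open>A\<close> fixes the coset \<open>A\<close>. The number of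
  fixed cosets is a multiple of \<open>p\<close>, so there is a second one.\<close>

lemma normalizing_element_outside:
  assumes P: "p_subgroup p P G" and A: "subgroup A G" "A \<subset> P"
  shows "\<exists>x\<in>P - A. \<forall>a\<in>A. a \<^bold>^ x \<in> A"
proof -
  have PG: "subgroup P G" using P by (simp add: p_subgroup_def)
  interpret P: finite_group_at_prime "G\<lparr>carrier := P\<rparr>" p using PG by (rule subgroup_at_prime)
  let ?G = "G\<lparr>carrier := P\<rparr>"
  have A': "subgroup A ?G" using A PG by (simp add: subgroup_restrict_iff)
  have pA: "p_subgroup p A ?G"
    using A A' P PG prime_p dvd_card_subgroup[of A P] divides_primepow_nat
    by (auto simp: p_subgroup_def)
  let ?F = "{C \<in> rcosets\<^bsub>?G\<^esub> A. \<forall>r\<in>A. C #>\<^bsub>?G\<^esub> r = C}"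
  have "p dvd card (rcosets\<^bsub>?G\<^esub> A)"
    using prime_dvd_proper_index[OF P A] P.card_rcosets_eq_div[OF P.finite_carrier A']
    by (simp add: order_def)
  then have pF: "p dvd card ?F"
    using P.fixed_cosets_cong[OF A' pA] by (simp add: cong_dvd_iff)
  have AF: "A \<in> ?F"
    using subgroup.subgroup_in_rcosets[OF A' P.is_group] A' P.coset_join2 A by auto
  have "?F \<noteq> {A}" using pF prime_p by (metis card_1_singleton_iff One_nat_def not_prime_unit)
  then obtain C where C: "C \<in> ?F" "C \<noteq> A" using AF by blast
  then obtain x where x: "x \<in> P" "C = A #>\<^bsub>?G\<^esub> x" by (auto simp: RCOSETS_def)
  have xA: "x \<notin> A" using C x A' P.coset_join2[of x A] by auto
  have "x \<otimes> r \<otimes> inv x \<in> A" if "r \<in> A" for r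
    using C x P.rcoset_fixed_iff[OF A', of x r] that A PG by auto
  then have "\<forall>a\<in>A. a \<^bold>^ (inv x) \<in> A"
    using x PG subgroup.mem_carrier[OF PG] by (simp add: conj_elt_def)
  moreover have "inv x \<in> P - A" using x xA A(1) PG
    by (metis Diff_iff inv_inv subgroup.m_inv_closed subgroup.mem_carrier)
  ultimately show ?thesis by blast
qed

lemma normalizers_grow:
  assumes P: "p_subgroup p P G" and A: "subgroup A G" "A \<subset> P"
  shows "A \<subset> {x \<in> P. (\<lambda>a. a \<^bold>^ x) ` A = A}"
proof -
  interpret A: subgroup A G using A by simp
  have PG: "P \<subseteq> carrier G" using P by (auto simp: p_subgroup_def subgroup.subset)
  have "(\<lambda>a. a \<^bold>^ x) ` A = A" if "x \<in> A" for x
    by (rule conj_image_eq_self[OF A(1)]) (use that in \<open>auto simp: conj_elt_def\<close>)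
  then have "A \<subseteq> {x \<in> P. (\<lambda>a. a \<^bold>^ x) ` A = A}" using A(2) by blast
  moreover obtain x where "x \<in> P - A" "\<forall>a\<in>A. a \<^bold>^ x \<in> A"
    using normalizing_element_outside[OF P A] by blast
  then have "x \<in> {x \<in> P. (\<lambda>a. a \<^bold>^ x) ` A = A}" "x \<notin> A"
    using conj_image_eq_self[OF A(1), of x] PG by auto
  ultimately show ?thesis by blast
qed

text \<open>This is the nontriviality of the centre of \<open>P/L\<close>: under conjugation by \<open>P\<close> the coset \<open>L\<close> is fixed,
  and the number of fixed cosets is a multiple of \<open>p\<close>, so a second coset is fixed.\<close>

lemma central_element_modulo_normal:
  assumes P: "p_subgroup p P G" and L: "subgroup L G" "L \<subset> P"
    and norm: "\<And>a x. a \<in> L \<Longrightarrow> x \<in> P \<Longrightarrow> a \<^bold>^ x \<in> L"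
  shows "\<exists>a\<in>P - L. \<forall>x\<in>P. inv a \<otimes> a \<^bold>^ x \<in> L"
proof -
  have PG: "subgroup P G" using P by (simp add: p_subgroup_def)
  obtain k where k: "card P = p ^ k" using P by (auto simp: p_subgroup_def)
  interpret Ps: subgroup P G by fact
  interpret Ls: subgroup L G using L by simp
  interpret P: finite_group_at_prime "G\<lparr>carrier := P\<rparr>" p using PG by (rule subgroup_at_prime)
  let ?G = "G\<lparr>carrier := P\<rparr>"
  define E where "E = (\<lambda>a. L #> a) ` P"
  have ER: "E = rcosets\<^bsub>?G\<^esub> L" by (auto simp: E_def RCOSETS_def)
  define act where "act g C = (\<lambda>y. y \<^bold>^ (inv g)) ` C" for g C
  have act: "act g (L #> a) = L #> (a \<^bold>^ (inv g))" if "g \<in> P" "a \<in> P" for g a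
  proof -
    have Lg: "(\<lambda>y. y \<^bold>^ (inv g)) ` L = L"
    proof (intro equalityI subsetI)
      fix y assume "y \<in> L"
      moreover from this have "y = (y \<^bold>^ g) \<^bold>^ (inv g)" using that by simp
      ultimately show "y \<in> (\<lambda>y. y \<^bold>^ (inv g)) ` L" using norm that by blast
    qed (use norm that in auto)
    have "act g (L #> a) = (\<lambda>y. y \<^bold>^ (inv g) \<otimes> a \<^bold>^ (inv g)) ` L"
      using that by (auto simp: act_def r_coset_def image_iff conj_mult)
    also have "\<dots> = ((\<lambda>y. y \<^bold>^ (inv g)) ` L) #> (a \<^bold>^ (inv g))"
      by (auto simp: r_coset_def)
    finally show ?thesis unfolding Lg .
  qed
  have cP: "a \<^bold>^ g \<in> P" if "a \<in> P" "g \<in> P" for a g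
    using that by (auto simp: conj_elt_def)
  let ?F = "{C \<in> E. \<forall>g\<in>carrier ?G. act g C = C}"
  have finE: "finite E"
    using PG by (simp add: E_def subgroup_finite)
  have F: "[card E = card ?F] (mod p)"
  proof (rule p_power_action_fixed_points)
    show "act g x \<in> E" if "g \<in> carrier ?G" "x \<in> E" for g x
      using that cP by (auto simp: E_def act)
    show "act \<one>\<^bsub>?G\<^esub> x = x" if "x \<in> E" for x using that by (auto simp: E_def act)
    show "act (g \<otimes>\<^bsub>?G\<^esub> h) x = act g (act h x)"
      if gh: "g \<in> carrier ?G" "h \<in> carrier ?G" "x \<in> E" for g h x
    proof -
      obtain a where "a \<in> P" "x = L #> a" using gh by (auto simp: E_def)
      then show ?thesis
        using gh act[of "g \<otimes> h" a] act[of h a] act[of g "a \<^bold>^ (inv h)"] cP[of a "inv h"]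
        by (simp add: conj_conj inv_mult_group)
    qed
  qed (use prime_p k finE in \<open>simp_all add: P.is_group\<close>)
  have L': "subgroup L ?G" using L PG by (simp add: subgroup_restrict_iff)
  have "p dvd card E"
    using prime_dvd_proper_index[OF P L] P.card_rcosets_eq_div[OF P.finite_carrier L']
    by (simp add: order_def ER)
  then have pF: "p dvd card ?F" using F by (simp add: cong_dvd_iff)
  have L1: "L #> \<one> = L" by (simp add: Ls.subset)
  have "act g L = L" if "g \<in> P" for g using act[of g \<one>] that by (simp add: L1)
  moreover have "L \<in> E" unfolding E_def by (rule rev_image_eqI[of \<one>]) (simp_all add: L1)
  ultimately have "L \<in> ?F" by simp
  moreover have "?F \<noteq> {L}" using pF prime_p by (metis card_1_singleton_iff One_nat_def not_prime_unit)
  ultimately obtain C where C: "C \<in> ?F" "C \<noteq> L" by blast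
  then obtain a where a: "a \<in> P" "C = L #> a" by (auto simp: E_def)
  have aL: "a \<notin> L" using C a coset_join2[of a L] L(1) by auto
  have "inv a \<otimes> a \<^bold>^ x \<in> L" if x: "x \<in> P" for x
  proof -
    have "L #> (a \<^bold>^ x) = L #> a" using C a act[of "inv x" a] x by auto
    then have "a \<^bold>^ x \<in> L #> a" using rcos_self[of "a \<^bold>^ x" L] a x L(1) by auto
    then obtain l where l: "l \<in> L" "a \<^bold>^ x = l \<otimes> a" by (auto simp: r_coset_def)
    then have "inv a \<otimes> a \<^bold>^ x = l \<^bold>^ a" using a by (simp add: conj_elt_def m_assoc)
    then show ?thesis using norm l a by simp
  qed
  then show ?thesis using a aL by blast
qed

end

section \<open>Homomorphisms into the integers modulo n\<close>

context group
begin

text \<open>A homomorphism from \<open>H\<close> to the integers modulo \<open>n\<close>, represented by integer values. In this form the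
  transfer is an ordinary finite sum of integers instead of a product in a quotient group.\<close>

definition additive_mod :: "int \<Rightarrow> 'a set \<Rightarrow> ('a \<Rightarrow> int) \<Rightarrow> bool" where
  "additive_mod n H f \<longleftrightarrow> (\<forall>x\<in>H. \<forall>y\<in>H. [f (x \<otimes> y) = f x + f y] (mod n))"

lemma additive_modD:
  "\<lbrakk>additive_mod n H f; x \<in> H; y \<in> H\<rbrakk> \<Longrightarrow> [f (x \<otimes> y) = f x + f y] (mod n)"
  by (simp add: additive_mod_def)

lemma additive_mod_one:
  assumes "subgroup H G" "additive_mod n H f"
  shows "[f \<one> = 0] (mod n)"
proof -
  have "[f \<one> = f \<one> + f \<one>] (mod n)"
    using additive_modD[OF assms(2), of \<one> \<one>] assms(1) by (simp add: subgroup.one_closed)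
  then show ?thesis by (simp add: cong_iff_dvd_diff)
qed

lemma additive_mod_inv:
  assumes "subgroup H G" "additive_mod n H f" "x \<in> H"
  shows "[f (inv x) = - f x] (mod n)"
proof -
  have "[f (x \<otimes> inv x) = f x + f (inv x)] (mod n)"
    using additive_modD[OF assms(2), of x "inv x"] assms by (simp add: subgroup.m_inv_closed)
  then have "[f \<one> = f x + f (inv x)] (mod n)"
    using assms by (simp add: subgroup.mem_carrier)
  then have "[f x + f (inv x) = 0] (mod n)"
    using additive_mod_one[OF assms(1,2)] cong_sym cong_trans by blast
  then show ?thesis by (simp add: cong_iff_dvd_diff add.commute)
qed

lemma additive_mod_nat_pow:
  assumes "subgroup H G" "additive_mod n H f" "x \<in> H"
  shows "[f (x [^] (k::nat)) = int k * f x] (mod n)"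
proof (induction k)
  case 0
  then show ?case using additive_mod_one[OF assms(1,2)] by simp
next
  case (Suc k)
  have "[f (x [^] Suc k) = f (x [^] k) + f x] (mod n)"
    using additive_modD[OF assms(2), of "x [^] k" x] assms by (simp add: subgroup_nat_pow_closed)
  also have "[f (x [^] k) + f x = int k * f x + f x] (mod n)"
    using Suc.IH by (intro cong_add cong_refl)
  finally show ?case by (simp add: algebra_simps)
qed

lemma additive_mod_int_pow:
  assumes "subgroup H G" "additive_mod n H f" "x \<in> H"
  shows "[f (x [^] (i::int)) = i * f x] (mod n)"
proof (cases i rule: int_cases2)
  case (nonneg k)
  then show ?thesis using additive_mod_nat_pow[OF assms, of k] by (simp add: int_pow_int)
next
  case (nonpos k)
  have xk: "x [^] k \<in> H" using assms by (simp add: subgroup_nat_pow_closed)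
  have "x [^] i = inv (x [^] k)"
    using assms nonpos by (simp add: int_pow_neg int_pow_int subgroup.mem_carrier)
  moreover have "[- f (x [^] k) = - (int k * f x)] (mod n)"
    using additive_mod_nat_pow[OF assms, of k] by (simp add: cong_minus_minus_iff)
  ultimately show ?thesis using additive_mod_inv[OF assms(1,2) xk] nonpos cong_trans by fastforce
qed

lemma additive_mod_conj:
  assumes "subgroup H G" "additive_mod n H f" "x \<in> H" "g \<in> H"
  shows "[f (x \<^bold>^ g) = f x] (mod n)"
proof -
  have ig: "inv g \<in> H" using assms by (simp add: subgroup.m_inv_closed)
  have "[f (inv g \<otimes> x \<otimes> g) = f (inv g \<otimes> x) + f g] (mod n)"
    using assms ig by (intro additive_modD[OF assms(2)]) (auto intro: subgroup.m_closed)
  also have "[f (inv g \<otimes> x) + f g = f (inv g) + f x + f g] (mod n)"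
    using assms ig by (intro cong_add cong_refl additive_modD[OF assms(2)])
  also have "[f (inv g) + f x + f g = - f g + f x + f g] (mod n)"
    using additive_mod_inv[OF assms(1,2,4)] by (intro cong_add cong_refl)
  finally show ?thesis by (simp add: conj_elt_def)
qed

lemma additive_mod_kernel:
  assumes "subgroup H G" "additive_mod n H f"
  shows "subgroup {x \<in> H. [f x = 0] (mod n)} G"
proof -
  interpret H: subgroup H G by fact
  show ?thesis
  proof (rule subgroupI)
    show "{x \<in> H. [f x = 0] (mod n)} \<noteq> {}"
      using additive_mod_one[OF assms] H.one_closed by blast
    show "inv x \<in> {x \<in> H. [f x = 0] (mod n)}" if "x \<in> {x \<in> H. [f x = 0] (mod n)}" for x
    proof -
      have x: "x \<in> H" "[f x = 0] (mod n)" using that by auto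
      have "[- f x = 0] (mod n)" using x(2) by (simp add: cong_iff_dvd_diff)
      then show ?thesis using cong_trans[OF additive_mod_inv[OF assms x(1)]] x(1) by simp
    qed
    show "x \<otimes> y \<in> {x \<in> H. [f x = 0] (mod n)}"
      if "x \<in> {x \<in> H. [f x = 0] (mod n)}" "y \<in> {x \<in> H. [f x = 0] (mod n)}" for x y
    proof -
      have xy: "x \<in> H" "y \<in> H" "[f x = 0] (mod n)" "[f y = 0] (mod n)" using that by auto
      have "[f x + f y = 0] (mod n)" using cong_add[OF xy(3,4)] by simp
      then show ?thesis using cong_trans[OF additive_modD[OF assms(2) xy(1,2)]] xy by simp
    qed
  qed auto
qed

end

context finite_group_at_prime
begin

lemma maximal_subgroup_exists:
  assumes "p_subgroup p P G" "P \<noteq> {\<one>}"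
  obtains M where "subgroup M G" "M \<subset> P" "\<And>K. subgroup K G \<Longrightarrow> M \<subset> K \<Longrightarrow> K \<subseteq> P \<Longrightarrow> K = P"
proof -
  have P: "subgroup P G" "finite P" using assms by (auto simp: p_subgroup_def subgroup_finite)
  let ?S = "{K. subgroup K G \<and> K \<subset> P}"
  have "finite ?S" using P by (auto intro: finite_subset[of _ "Pow P"])
  moreover have "{\<one>} \<in> ?S" using assms P triv_subgroup subgroup.one_closed by fastforce
  then have "?S \<noteq> {}" by blast
  ultimately obtain M where M: "M \<in> ?S" "\<forall>K\<in>?S. M \<subseteq> K \<longrightarrow> M = K"
    using finite_has_maximal[of ?S] by blast
  then show ?thesis using that[of M] by blast
qed

text \<open>A maximal subgroup \<open>M\<close> is normal because normalizers grow, and \<open>P/M\<close> is cyclic of order \<open>p\<close>,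
  generated by the class of any \<open>y\<close> outside \<open>M\<close>. The function \<open>f\<close> reads off the exponent \<open>i\<close> in \<open>x = my\<^sup>i\<close>.\<close>

lemma nonzero_additive_mod_exists:
  assumes P: "p_subgroup p P G" "P \<noteq> {\<one>}"
  obtains f y where "additive_mod (int p) P f" "y \<in> P" "\<not> [f y = 0] (mod int p)"
proof -
  obtain M where M: "subgroup M G" "M \<subset> P"
    and max: "\<And>K. subgroup K G \<Longrightarrow> M \<subset> K \<Longrightarrow> K \<subseteq> P \<Longrightarrow> K = P"
    using maximal_subgroup_exists[OF P] by blast
  have PG: "subgroup P G" using P by (simp add: p_subgroup_def)
  interpret P: subgroup P G by fact
  interpret M: subgroup M G by fact
  have "{x \<in> P. (\<lambda>a. a \<^bold>^ x) ` M = M} = P"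
    using normalizers_grow[OF P(1) M] normalizer_in_subgroup[OF PG M(1)] M(2)
    by (intro max) auto
  then have norm: "m \<^bold>^ x \<in> M" if "m \<in> M" "x \<in> P" for m x
    using that by blast
  let ?K = "\<lambda>z. {m \<otimes> z [^] (i::int) | m i. m \<in> M}"
  have gen: "?K z = P" if z: "z \<in> P" "z \<notin> M" for z
  proof (rule max)
    show "subgroup (?K z) G"
      using z norm by (intro mult_powers_subgroup M) auto
    have "m \<in> ?K z" if "m \<in> M" for m
      using that z by (intro CollectI exI[of _ m] exI[of _ "0::int"]) simp
    moreover have "z \<in> ?K z"
      using z by (intro CollectI exI[of _ \<one>] exI[of _ "1::int"]) simp
    ultimately show "M \<subset> ?K z" using z by blast
    show "?K z \<subseteq> P" using M(2) z PG subgroup_int_pow_closed by (auto intro!: P.m_closed)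
  qed
  obtain y where y: "y \<in> P" "y \<notin> M" using M(2) by blast
  obtain e where e: "y [^] (p ^ e) = \<one>" using p_subgroup_pow[OF P(1)] y by metis
  have bez: "y [^] (gcd i j) \<in> M" if "y [^] i \<in> M" "y [^] j \<in> M" for i j :: int
  proof -
    obtain u v where "u * i + v * j = gcd i j" using bezout_int by blast
    then have "y [^] (gcd i j) = (y [^] i) [^] u \<otimes> (y [^] j) [^] v"
      using y by (metis P.mem_carrier int_pow_mult int_pow_pow mult.commute)
    then show ?thesis using that M by (simp add: subgroup_int_pow_closed)
  qed
  have pe: "y [^] (int (p ^ e)) \<in> M" unfolding int_pow_int e by (rule M.one_closed)
  (* If y^p were outside M, it would generate P modulo M; then y would be congruent to y^(p i)
     for some i, and y^(1 - p i) in M would put y in M, since 1 - p i is prime to the order of y. *)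
  have yp: "y [^] (int p) \<in> M"
  proof (rule ccontr)
    assume "y [^] (int p) \<notin> M"
    moreover have "y [^] (int p) \<in> P" using y PG by (simp add: subgroup_int_pow_closed)
    ultimately have "y \<in> ?K (y [^] (int p))" using gen y(1) by simp
    then obtain m i where mi: "m \<in> M" "y = m \<otimes> (y [^] (int p)) [^] (i::int)" by blast
    have "y [^] (1 - int p * i) = y \<otimes> inv ((y [^] int p) [^] i)"
      using y(1) by (simp add: int_pow_diff int_pow_pow)
    also have "\<dots> = m"
      using mi y(1) by (metis P.mem_carrier M.mem_carrier int_pow_closed inv_solve_right)
    finally have "y [^] (1 - int p * i) \<in> M" using mi(1) by simp
    then have "y [^] (gcd (1 - int p * i) (int (p ^ e))) \<in> M" using bez pe by blast
    moreover have "coprime (1 - int p * i) (int p)"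
    proof (rule coprimeI)
      fix c assume "c dvd 1 - int p * i" "c dvd int p"
      then show "is_unit c" using dvd_add[of c "1 - int p * i" "int p * i"] by simp
    qed
    then have "gcd (1 - int p * i) (int (p ^ e)) = 1"
      by (simp add: coprime_iff_gcd_eq_1[symmetric])
    ultimately show False using y by simp
  qed
  have iff: "y [^] i \<in> M \<longleftrightarrow> int p dvd i" for i :: int
  proof
    assume "int p dvd i"
    then obtain j where "i = int p * j" by blast
    then show "y [^] i \<in> M" using yp y M by (simp add: subgroup_int_pow_closed flip: int_pow_pow)
  next
    assume i: "y [^] i \<in> M"
    show "int p dvd i"
    proof (rule ccontr)
      assume "\<not> int p dvd i"
      then have "coprime (int p) i" using prime_p by (simp add: prime_imp_coprime)
      then show False using bez[OF yp i] y by simp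
    qed
  qed
  define f where "f x = (SOME i::int. \<exists>m\<in>M. x = m \<otimes> y [^] i)" for x
  have fx: "\<exists>m\<in>M. x = m \<otimes> y [^] (f x)" if "x \<in> P" for x
  proof -
    have "x \<in> ?K y" using that gen[OF y] by simp
    then have "\<exists>i::int. \<exists>m\<in>M. x = m \<otimes> y [^] i" by blast
    then show ?thesis unfolding f_def by (rule someI_ex)
  qed
  have uniq: "[f x = i] (mod int p)" if x: "x \<in> P" "x \<otimes> y [^] (- i) \<in> M" for x and i :: int
  proof -
    obtain m where m: "m \<in> M" "x = m \<otimes> y [^] (f x)" using fx x by blast
    have "y [^] (k - i) = inv m \<otimes> (m \<otimes> y [^] k \<otimes> y [^] (- i))" for k :: int
      using m(1) y(1) by (simp add: m_assoc flip: int_pow_mult)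
    from this[of "f x"] have "y [^] (f x - i) = inv m \<otimes> (x \<otimes> y [^] (- i))"
      using m(2) by simp
    then have "y [^] (f x - i) \<in> M" using m(1) x(2) by simp
    then show ?thesis using iff by (simp add: cong_iff_dvd_diff)
  qed
  show thesis
  proof (rule that)
    show "additive_mod (int p) P f"
      unfolding additive_mod_def
    proof (intro ballI)
      fix x z assume xz: "x \<in> P" "z \<in> P"
      obtain m where m: "m \<in> M" "x = m \<otimes> y [^] (f x)" using fx xz by blast
      obtain n where n: "n \<in> M" "z = n \<otimes> y [^] (f z)" using fx xz by blast
      have "m \<otimes> y [^] k \<otimes> (n \<otimes> y [^] l) \<otimes> y [^] (- (k + l)) = m \<otimes> n \<^bold>^ (y [^] (- k))"
        for k l :: int
      proof -
        have 1: "y [^] l \<otimes> y [^] (- (k + l)) = y [^] (- k)" using y(1) by (simp flip: int_pow_mult)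
        have 2: "inv (y [^] (- k)) = y [^] k" using y(1) by (simp add: int_pow_neg)
        have "m \<otimes> y [^] k \<otimes> (n \<otimes> y [^] l) \<otimes> y [^] (- (k + l)) =
            m \<otimes> (y [^] k \<otimes> (n \<otimes> (y [^] l \<otimes> y [^] (- (k + l)))))"
          using m(1) n(1) y(1) by (simp add: m_assoc)
        then show ?thesis
          unfolding 1 conj_elt_def 2 using m(1) n(1) y(1) by (simp add: m_assoc)
      qed
      from this[of "f x" "f z"]
      have "x \<otimes> z \<otimes> y [^] (- (f x + f z)) = m \<otimes> n \<^bold>^ (y [^] (- f x))"
        using m(2) n(2) by simp
      also have "\<dots> \<in> M" using m(1) n(1) norm y(1) PG by (simp add: subgroup_int_pow_closed)
      finally show "[f (x \<otimes> z) = f x + f z] (mod int p)" using uniq xz by simp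
    qed
    show "y \<in> P" by fact
    show "\<not> [f y = 0] (mod int p)"
    proof
      assume "[f y = 0] (mod int p)"
      moreover have "[f y = 1] (mod int p)" by (rule uniq) (use y in \<open>simp_all add: int_pow_neg M.one_closed\<close>)
      ultimately have "[1 = (0::int)] (mod int p)" using cong_sym cong_trans by blast
      then show False using prime_p by (simp add: cong_iff_dvd_diff)
    qed
  qed
qed

end

section \<open>Control of fusion when p-regular elements act trivially on p-subgroups\<close>

text \<open>For a finite group and a prime \<open>p\<close> this is Frobenius' condition that \<open>N(Q)/C(Q)\<close> is a p-group for every
  p-subgroup \<open>Q\<close>, expressed without quotients.\<close>

definition p_regular_elements_centralize :: "nat \<Rightarrow> ('a, 'b) monoid_scheme \<Rightarrow> bool" where
  "p_regular_elements_centralize p G \<longleftrightarrow>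
     (\<forall>Q g. p_subgroup p Q G \<and> g \<in> carrier G \<and> coprime (group.ord G g) p \<and>
        (\<forall>a\<in>Q. conj_elt G a g \<in> Q) \<longrightarrow> (\<forall>a\<in>Q. conj_elt G a g = a))"

context finite_group_at_prime
begin

lemma sylow_exists:
  assumes "Factorial_Ring.prime q"
  obtains Q where "subgroup Q G" "card Q = q ^ multiplicity q (order G)"
    "\<not> q dvd order G div card Q"
proof -
  have pos: "order G \<noteq> 0" using order_gt_0_iff_finite finite_carrier by (metis less_not_refl)
  obtain m where m: "order G = q ^ multiplicity q (order G) * m" "\<not> q dvd m"
    using multiplicity_decompose'[of "order G" q] pos assms not_prime_unit by blast
  obtain Q where Q: "subgroup Q G" "card Q = q ^ multiplicity q (order G)"
    using sylow_thm[OF assms is_group m(1) finite_carrier] by blast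
  have "order G div card Q = m"
    using m Q(2) assms by (metis nonzero_mult_div_cancel_left not_prime_0 power_not_zero)
  then show ?thesis using that Q m(2) by blast
qed

lemma sylow_subgroup_facts:
  assumes "sylow_subgroup p P G"
  shows "subgroup P G" "p_subgroup p P G" "\<not> p dvd order G div card P" "\<not> p dvd card (rcosets P)"
proof -
  have cP: "card P = p ^ multiplicity p (order G)" using assms by (simp add: sylow_subgroup_def)
  show PG: "subgroup P G" using assms by (simp add: sylow_subgroup_def)
  show "p_subgroup p P G" using PG cP by (auto simp: p_subgroup_def)
  have "order G \<noteq> 0" using order_gt_0_iff_finite finite_carrier by (metis less_not_refl)
  then show ndvd: "\<not> p dvd order G div card P"
    using multiplicity_decompose[of "order G" p] prime_p not_prime_unit unfolding cP by blast
  show "\<not> p dvd card (rcosets P)" using ndvd PG by (simp add: card_rcosets_eq_div)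
qed

text \<open>For a prime \<open>q \<noteq> p\<close> a Sylow q-subgroup consists of p-regular elements and so lies in \<open>H\<close>. Therefore no
  prime divides the index of \<open>H\<close>.\<close>

lemma subgroup_eq_carrier:
  assumes H: "subgroup H G" and "\<not> p dvd order G div card H"
    and reg: "\<And>x. x \<in> carrier G \<Longrightarrow> coprime (ord x) p \<Longrightarrow> x \<in> H"
  shows "H = carrier G"
proof -
  define m where "m = card (rcosets H)"
  have mH: "m * card H = order G" using lagrange[OF H] by (simp add: m_def)
  have pm: "\<not> p dvd m" using assms(2) H by (simp add: m_def card_rcosets_eq_div)
  have "m = 1"
  proof (rule ccontr)
    assume "m \<noteq> 1"
    then obtain q where q: "Factorial_Ring.prime q" "q dvd m" using prime_factor_nat by blast
    then have qp: "q \<noteq> p" using pm by auto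
    obtain Q where Q: "subgroup Q G" "card Q = q ^ multiplicity q (order G)"
      "\<not> q dvd order G div card Q"
      using sylow_exists[OF q(1)] by blast
    have "x \<in> H" if x: "x \<in> Q" for x
    proof (rule reg)
      show "x \<in> carrier G" using x Q(1) by (meson subgroup.mem_carrier)
      have "ord x dvd q ^ multiplicity q (order G)"
        using ord_dvd_card_subgroup[OF finite_carrier Q(1) x] Q(2) by simp
      moreover have "coprime (q ^ multiplicity q (order G)) p"
        using qp q(1) prime_p by (simp add: primes_coprime)
      ultimately show "coprime (ord x) p" by (rule coprime_divisors[OF _ dvd_refl])
    qed
    then have "card Q dvd card H" by (intro dvd_card_subgroup H Q) auto
    (* One factor q more than the order of a Sylow q-subgroup allows. *)
    then have "q * card Q dvd order G" using q(2) mH by (metis mult_dvd_mono)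
    moreover have "card Q > 0" using subgroup.finite_imp_card_positive[OF Q(1) finite_carrier] .
    ultimately have "q dvd order G div card Q" by (simp add: dvd_div_iff_mult dvd_mult_right)
    then show False using Q(3) by simp
  qed
  then have "card H = card (carrier G)" using mH by (simp add: order_def)
  then show ?thesis using H by (simp add: card_subset_eq subgroup.subset)
qed

text \<open>The product \<open>CS\<close> is a subgroup of \<open>N\<close> to which \<open>subgroup_eq_carrier\<close> applies.\<close>

lemma factorization_over_p_regular_subgroup:
  assumes N: "subgroup N G" and C: "subgroup C G" "C \<subseteq> N" and S: "subgroup S G" "S \<subseteq> N"
    and norm: "\<And>c n. c \<in> C \<Longrightarrow> n \<in> N \<Longrightarrow> c \<^bold>^ n \<in> C"
    and reg: "\<And>x. x \<in> N \<Longrightarrow> coprime (ord x) p \<Longrightarrow> x \<in> C"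
    and ind: "\<not> p dvd card N div card S"
    and n: "n \<in> N"
  shows "\<exists>c\<in>C. \<exists>s\<in>S. n = c \<otimes> s"
proof -
  interpret N: finite_group_at_prime "G\<lparr>carrier := N\<rparr>" p using N by (rule subgroup_at_prime)
  interpret NG: subgroup N G by fact
  interpret CG: subgroup C G by fact
  interpret SG: subgroup S G by fact
  define H where "H = {c \<otimes> s | c s. c \<in> C \<and> s \<in> S}"
  have swap: "s \<otimes> c = c \<^bold>^ (inv s) \<otimes> s" if "s \<in> S" "c \<in> C" for s c
    using that by (simp add: conj_elt_def m_assoc)
  have HG: "subgroup H G"
  proof (rule subgroupI)
    show "H \<subseteq> carrier G" by (auto simp: H_def)
    show "H \<noteq> {}" unfolding H_def using CG.one_closed SG.one_closed by blast
  next
    fix x assume "x \<in> H"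
    then obtain c s where cs: "c \<in> C" "s \<in> S" "x = c \<otimes> s" by (auto simp: H_def)
    then have "inv x = inv s \<otimes> inv c" by (simp add: inv_mult_group)
    also have "\<dots> = (inv c) \<^bold>^ (inv (inv s)) \<otimes> inv s" using cs(1,2) by (intro swap) auto
    finally show "inv x \<in> H" using cs norm[of "inv c" s] S(2) by (auto simp: H_def)
  next
    fix x y assume "x \<in> H" "y \<in> H"
    then obtain c s d t where cs: "c \<in> C" "s \<in> S" "x = c \<otimes> s" "d \<in> C" "t \<in> S" "y = d \<otimes> t"
      by (auto simp: H_def)
    then have "x \<otimes> y = c \<otimes> (s \<otimes> d) \<otimes> t" by (simp add: m_assoc)
    also have "s \<otimes> d = d \<^bold>^ (inv s) \<otimes> s" using cs by (intro swap) auto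
    also have "c \<otimes> (d \<^bold>^ (inv s) \<otimes> s) \<otimes> t = (c \<otimes> d \<^bold>^ (inv s)) \<otimes> (s \<otimes> t)"
      using cs(1,2,4,5) by (simp add: m_assoc)
    finally show "x \<otimes> y \<in> H" using cs norm[of d "inv s"] S(2) by (auto simp: H_def)
  qed
  have HN: "H \<subseteq> N" using C(2) S(2) by (auto simp: H_def)
  have CH: "C \<subseteq> H"
  proof
    fix c assume "c \<in> C"
    then show "c \<in> H" unfolding H_def by (intro CollectI exI[of _ c] exI[of _ \<one>]) simp
  qed
  have SH: "S \<subseteq> H"
  proof
    fix s assume "s \<in> S"
    then show "s \<in> H" unfolding H_def by (intro CollectI exI[of _ \<one>] exI[of _ s]) simp
  qed
  have "H = carrier (G\<lparr>carrier := N\<rparr>)"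
  proof (rule N.subgroup_eq_carrier)
    show "subgroup H (G\<lparr>carrier := N\<rparr>)" using N HG HN by (simp add: subgroup_restrict_iff)
    have "card S dvd card H" using S(1) HG SH by (intro dvd_card_subgroup) auto
    moreover have "card H dvd card N" using N HG HN by (intro dvd_card_subgroup) auto
    moreover have "card S > 0" using S by (simp add: subgroup.finite_imp_card_positive)
    ultimately have "card N div card H dvd card N div card S"
      by (auto elim!: dvdE)
    then show "\<not> p dvd order (G\<lparr>carrier := N\<rparr>) div card H"
      using ind by (auto simp: order_def)
    show "x \<in> H" if "x \<in> carrier (G\<lparr>carrier := N\<rparr>)" "coprime (N.ord x) p" for x
      using that reg CH N by (auto simp: ord_subgroup)
  qed
  then have "n \<in> H" using n by simp
  then show ?thesis by (auto simp: H_def)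
qed

text \<open>The centralizer of \<open>B\<close> is normal in the normalizer \<open>N\<close> and, by hypothesis, contains the p-regular
  elements of \<open>N\<close>. So every element of \<open>N\<close> acts on \<open>B\<close> as an element of the Sylow subgroup \<open>S\<close> does.\<close>

lemma normalizer_factorization:
  assumes reg: "p_regular_elements_centralize p G" and B: "p_subgroup p B G"
    and N: "N = {x \<in> carrier G. (\<lambda>b. b \<^bold>^ x) ` B = B}"
    and S: "subgroup S G" "S \<subseteq> N" "\<not> p dvd card N div card S" and n: "n \<in> N"
  shows "\<exists>c\<in>N. \<exists>s\<in>S. n = c \<otimes> s \<and> (\<forall>b\<in>B. b \<^bold>^ c = b)"
proof -
  have BG: "subgroup B G" using B by (simp add: p_subgroup_def)
  interpret B: subgroup B G by fact
  have NG: "subgroup N G"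
    unfolding N by (rule normalizer_in_subgroup) (auto simp: BG subgroup_self B.subset)
  interpret NG: subgroup N G by fact
  let ?C = "{c \<in> N. \<forall>b\<in>B. b \<^bold>^ c = b}"
  have CG: "subgroup ?C G"
  proof (rule subgroupI)
    show "?C \<noteq> {}" using NG.one_closed by (auto intro!: exI[of _ \<one>])
    show "inv c \<in> ?C" if "c \<in> ?C" for c
    proof -
      have "b \<^bold>^ (inv c) = b" if "b \<in> B" for b
        using \<open>c \<in> ?C\<close> that conj_conj_inv(1)[of b c] by simp
      then show ?thesis using that by simp
    qed
    show "c \<otimes> d \<in> ?C" if "c \<in> ?C" "d \<in> ?C" for c d
      using that by (auto simp flip: conj_conj)
  qed auto
  have "\<exists>c\<in>?C. \<exists>s\<in>S. n = c \<otimes> s"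
  proof (rule factorization_over_p_regular_subgroup[OF NG CG _ S(1,2) _ _ S(3) n])
    fix c m assume c: "c \<in> ?C" and m: "m \<in> N"
    have "b \<^bold>^ (c \<^bold>^ m) = b" if b: "b \<in> B" for b
    proof -
      have "(\<lambda>b. b \<^bold>^ (inv m)) ` B = B" using NG.m_inv_closed[OF m] unfolding N by blast
      then have "b \<^bold>^ (inv m) \<in> B" using b by blast
      then have "b \<^bold>^ (inv m) \<^bold>^ c \<^bold>^ m = b" using c m b by simp
      moreover have "c \<^bold>^ m = inv m \<otimes> c \<otimes> m" by (simp add: conj_elt_def)
      ultimately show ?thesis using c m b by (simp add: conj_conj m_assoc)
    qed
    then show "c \<^bold>^ m \<in> ?C" using c m by (simp add: conj_elt_def)
  next
    fix x assume "x \<in> N" "coprime (ord x) p"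
    moreover have "\<forall>b\<in>B. b \<^bold>^ x \<in> B" using \<open>x \<in> N\<close> unfolding N by blast
    ultimately show "x \<in> ?C"
      using reg B unfolding p_regular_elements_centralize_def by simp
  qed auto
  then show ?thesis by blast
qed

text \<open>Downward induction on the order of \<open>A\<close>. For \<open>A = P\<close> the element \<open>g\<close> normalizes \<open>P\<close> and
  \<open>normalizer_factorization\<close> gives the claim. Otherwise put \<open>B = A\<^sup>g\<close>. The normalizers \<open>A1\<close> of \<open>A\<close> and
  \<open>B1\<close> of \<open>B\<close> in \<open>P\<close> are strictly larger. Both \<open>B1\<close> and the image of \<open>A1\<close> under \<open>g\<close> normalize \<open>B\<close>, so elements
  \<open>c1\<close> and \<open>c2\<close> centralizing \<open>B\<close> carry them into one Sylow subgroup \<open>T\<close> of the normalizer of \<open>B\<close>, and some \<open>h\<close>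
  carries \<open>T\<close> into \<open>P\<close>. The induction hypothesis replaces \<open>c1h\<close> on \<open>B1\<close> and \<open>gc2h\<close> on \<open>A1\<close> by elements
  \<open>x1\<close> and \<open>x2\<close> of \<open>P\<close>. On \<open>B\<close> the elements \<open>c1h\<close> and \<open>c2h\<close> act alike, so \<open>g\<close> acts on \<open>A\<close> as \<open>x2x1\<inverse>\<close> does.\<close>

lemma sylow_controls_fusion:
  assumes reg: "p_regular_elements_centralize p G"
    and P: "p_subgroup p P G" "\<not> p dvd order G div card P"
    and A: "subgroup A G" "A \<subseteq> P" and g: "g \<in> carrier G" "\<And>a. a \<in> A \<Longrightarrow> a \<^bold>^ g \<in> P"
  shows "\<exists>x\<in>P. \<forall>a\<in>A. a \<^bold>^ g = a \<^bold>^ x"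
  using A g
proof (induction "card P - card A" arbitrary: A g rule: less_induct)
  case less
  note A = less.prems(1,2) and g = less.prems(3,4)
  have PG: "subgroup P G" using P by (simp add: p_subgroup_def)
  interpret P: subgroup P G by fact
  interpret A: subgroup A G by (rule A)
  have finP: "finite P" using PG by (simp add: subgroup_finite)
  define B where "B = (\<lambda>a. a \<^bold>^ g) ` A"
  have BG: "subgroup B G" unfolding B_def using A(1) g(1) by (rule subgroup_conj)
  interpret B: subgroup B G by fact
  have BP: "B \<subseteq> P" using g by (auto simp: B_def)
  have cB: "card B = card A" unfolding B_def using g(1) A.subset by (simp add: card_image conj_inj_on)
  have pB: "p_subgroup p B G" using P(1) BG BP by (rule p_subgroup_mono)
  define N where "N = {x \<in> carrier G. (\<lambda>b. b \<^bold>^ x) ` B = B}"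
  have NG: "subgroup N G"
    unfolding N_def by (rule normalizer_in_subgroup) (auto simp: BG subgroup_self B.subset)
  interpret N: subgroup N G by fact
  show ?case
  proof (cases "A = P")
    case True
    have Pg: "(\<lambda>a. a \<^bold>^ g) ` P = P" using g True PG by (intro conj_image_eq_self) auto
    then have BP': "B = P" by (simp add: B_def True)
    have "g \<in> N" unfolding N_def BP' using g(1) Pg by blast
    have "(\<lambda>b. b \<^bold>^ x) ` B = B" if "x \<in> P" for x
      unfolding BP' by (rule conj_image_eq_self[OF PG]) (use that in \<open>auto simp: conj_elt_def\<close>)
    then have PN: "P \<subseteq> N" unfolding N_def using P.subset by blast
    have "card N div card P dvd order G div card P"
      using dvd_card_subgroup[OF finite_carrier PG NG PN]
        dvd_card_subgroup[OF finite_carrier NG subgroup_self N.subset]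
      by (metis order_def div_dvd_div dvd_trans)
    then have "\<not> p dvd card N div card P" using P(2) dvd_trans by blast
    then obtain c s where cs: "c \<in> N" "s \<in> P" "g = c \<otimes> s" "\<forall>b\<in>B. b \<^bold>^ c = b"
      using normalizer_factorization[OF reg pB N_def PG PN _ \<open>g \<in> N\<close>] by blast
    then have "a \<^bold>^ g = a \<^bold>^ s" if "a \<in> A" for a
      using that True BP' by (simp flip: conj_conj)
    then show ?thesis using cs(2) by blast
  next
    case False
    then have AP: "A \<subset> P" using A(2) by blast
    then have "card A < card P" using finP by (simp add: psubset_card_mono)
    then have BsP: "B \<subset> P" using BP cB by auto
    define A1 where "A1 = {x \<in> P. (\<lambda>a. a \<^bold>^ x) ` A = A}"
    define B1 where "B1 = {x \<in> P. (\<lambda>a. a \<^bold>^ x) ` B = B}"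
    have A1: "A \<subset> A1" "subgroup A1 G" "A1 \<subseteq> P"
      using normalizers_grow[OF P(1) A(1) AP] normalizer_in_subgroup[OF PG A] by (auto simp: A1_def)
    have B1: "B \<subset> B1" "subgroup B1 G" "B1 \<subseteq> P"
      using normalizers_grow[OF P(1) BG BsP] normalizer_in_subgroup[OF PG BG BP] by (auto simp: B1_def)
    have IH: "\<exists>x\<in>P. \<forall>a\<in>K. a \<^bold>^ k = a \<^bold>^ x"
      if K: "subgroup K G" "K \<subseteq> P" "card A < card K" and k: "k \<in> carrier G" "\<And>a. a \<in> K \<Longrightarrow> a \<^bold>^ k \<in> P"
      for K k
    proof (rule less.hyps[OF _ K(1,2) k])
      show "card P - card K < card P - card A"
        using K(3) \<open>card A < card P\<close> by linarith
    qed
    interpret NN: finite_group_at_prime "G\<lparr>carrier := N\<rparr>" p using NG by (rule subgroup_at_prime)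
    obtain T where T: "subgroup T (G\<lparr>carrier := N\<rparr>)"
        "card T = p ^ multiplicity p (order (G\<lparr>carrier := N\<rparr>))"
        "\<not> p dvd order (G\<lparr>carrier := N\<rparr>) div card T"
      using NN.sylow_exists[OF prime_p] by blast
    have TG: "subgroup T G" "T \<subseteq> N" using T(1) NG by (simp_all add: subgroup_restrict_iff)
    have pT: "p_subgroup p T G" using T(2) TG(1) by (auto simp: p_subgroup_def)
    have Ti: "\<not> p dvd card N div card T" using T(3) by (simp add: order_def)
    interpret T: subgroup T G by (rule TG)
    have into_T: "\<exists>c\<in>N. (\<forall>b\<in>B. b \<^bold>^ c = b) \<and> (\<forall>r\<in>R. r \<^bold>^ c \<in> T)"
      if R: "p_subgroup p R G" "R \<subseteq> N" for R
    proof -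
      obtain n where n: "n \<in> N" "\<forall>r\<in>R. r \<^bold>^ n \<in> T"
        using sylow_conjugate_within[OF NG TG Ti R] by blast
      obtain c s where cs: "c \<in> N" "s \<in> T" "n = c \<otimes> s" "\<forall>b\<in>B. b \<^bold>^ c = b"
        using normalizer_factorization[OF reg pB N_def TG Ti n(1)] by blast
      have "r \<^bold>^ c \<in> T" if r: "r \<in> R" for r
      proof -
        have rG: "r \<in> carrier G" using r R(2) by auto
        have "r \<^bold>^ n \<^bold>^ (inv s) = r \<^bold>^ c"
          using cs(1,2) rG unfolding cs(3) by (simp add: conj_conj m_assoc)
        moreover have "r \<^bold>^ n \<^bold>^ (inv s) \<in> T" using n(2) r cs(2) by (simp add: conj_elt_def)
        ultimately show ?thesis by simp
      qed
      then show ?thesis using cs by blast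
    qed
    have Pi: "\<not> p dvd card (rcosets P)" using P(2) PG by (simp add: card_rcosets_eq_div)
    obtain h where h: "h \<in> carrier G" "\<forall>t\<in>T. t \<^bold>^ h \<in> P"
      using sylow_conjugate[OF PG Pi pT] by blast
    have "B1 \<subseteq> N" unfolding B1_def N_def using P.subset by blast
    then obtain c1 where c1: "c1 \<in> N" "\<forall>b\<in>B. b \<^bold>^ c1 = b" "\<forall>r\<in>B1. r \<^bold>^ c1 \<in> T"
      using into_T[of B1] p_subgroup_mono[OF P(1) B1(2,3)] by blast
    have "(\<lambda>a. a \<^bold>^ g) ` A1 \<subseteq> N"
    proof
      fix y assume "y \<in> (\<lambda>a. a \<^bold>^ g) ` A1"
      then obtain x where x: "x \<in> A1" "y = x \<^bold>^ g" by blast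
      have xG: "x \<in> carrier G" "(\<lambda>a. a \<^bold>^ x) ` A = A" using x(1) by (auto simp: A1_def)
      have "b \<^bold>^ y \<in> B" if b: "b \<in> B" for b
      proof -
        obtain a where a: "a \<in> A" "b = a \<^bold>^ g" using b by (auto simp: B_def)
        have "b \<^bold>^ y = a \<^bold>^ x \<^bold>^ g"
          unfolding a(2) x(2) using a(1) xG(1) g(1) by (simp add: conj_elt_def m_assoc inv_mult_group)
        moreover have "a \<^bold>^ x \<in> A" using a(1) xG(2) by blast
        ultimately show ?thesis by (auto simp: B_def)
      qed
      moreover have "y \<in> carrier G" using x(2) xG(1) g(1) by simp
      ultimately show "y \<in> N" unfolding N_def using conj_image_eq_self[OF BG] by blast
    qed
    then obtain c2 where c2: "c2 \<in> N" "\<forall>b\<in>B. b \<^bold>^ c2 = b" "\<forall>r\<in>A1. r \<^bold>^ g \<^bold>^ c2 \<in> T"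
      using into_T[OF p_subgroup_conj[OF p_subgroup_mono[OF P(1) A1(2,3)] g(1)]] by auto
    have A1G: "a \<in> carrier G" if "a \<in> A1" for a using that by (auto simp: A1_def)
    have B1G: "a \<in> carrier G" if "a \<in> B1" for a using that by (auto simp: B1_def)
    have "\<exists>x\<in>P. \<forall>a\<in>B1. a \<^bold>^ (c1 \<otimes> h) = a \<^bold>^ x"
    proof (rule IH[OF B1(2,3)])
      show "card A < card B1"
        using psubset_card_mono[OF _ B1(1)] B1(2) cB by (simp add: subgroup_finite)
    qed (use c1 h B1G in \<open>auto simp flip: conj_conj\<close>)
    then obtain x1 where x1: "x1 \<in> P" "\<forall>a\<in>B1. a \<^bold>^ (c1 \<otimes> h) = a \<^bold>^ x1" by blast
    have "\<exists>x\<in>P. \<forall>a\<in>A1. a \<^bold>^ (g \<otimes> c2 \<otimes> h) = a \<^bold>^ x"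
    proof (rule IH[OF A1(2,3)])
      show "card A < card A1"
        using psubset_card_mono[OF _ A1(1)] A1(2) by (simp add: subgroup_finite)
    qed (use c2 h g(1) A1G in \<open>auto simp flip: conj_conj\<close>)
    then obtain x2 where x2: "x2 \<in> P" "\<forall>a\<in>A1. a \<^bold>^ (g \<otimes> c2 \<otimes> h) = a \<^bold>^ x2" by blast
    have "a \<^bold>^ g = a \<^bold>^ (x2 \<otimes> inv x1)" if a: "a \<in> A" for a
    proof -
      have aG: "a \<in> carrier G" using a by simp
      have b: "a \<^bold>^ g \<in> B" using a by (auto simp: B_def)
      have "a \<^bold>^ x2 = a \<^bold>^ g \<^bold>^ c2 \<^bold>^ h"
        using x2(2) a A1(1) aG g(1) c2(1) h(1) by (auto simp: conj_conj)
      also have "\<dots> = a \<^bold>^ g \<^bold>^ h" using c2(2) b by simp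
      also have "\<dots> = a \<^bold>^ g \<^bold>^ c1 \<^bold>^ h" using c1(2) b by simp
      also have "\<dots> = a \<^bold>^ g \<^bold>^ x1"
        using x1(2) b B1(1) aG g(1) c1(1) h(1) conj_conj[of "a \<^bold>^ g" c1 h] by auto
      finally have "a \<^bold>^ x2 \<^bold>^ (inv x1) = a \<^bold>^ g" using aG g(1) x1(1) by simp
      then show ?thesis using aG x1(1) x2(1) by (simp add: conj_conj)
    qed
    then show ?thesis using x1(1) x2(1) by blast
  qed
qed

end

section \<open>Transfer into the integers modulo n\<close>

context group
begin

text \<open>The transfer from \<open>G\<close> to \<open>H\<close> followed by \<open>f\<close>, computed from the coset representatives \<open>s\<close>.\<close>

definition transfer_sum :: "'a set \<Rightarrow> ('a set \<Rightarrow> 'a) \<Rightarrow> ('a \<Rightarrow> int) \<Rightarrow> 'a \<Rightarrow> int" where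
  "transfer_sum H s f g = (\<Sum>C\<in>rcosets H. f (s C \<otimes> g \<otimes> inv (s (C #> g))))"

text \<open>The factors \<open>c(C,g) = s(C) g s(Cg)\<inverse>\<close> satisfy \<open>c(C,gh) = c(C,g) c(Cg,h)\<close>, and \<open>g\<close> permutes the cosets.
  Since any choice of representatives yields a homomorphism, they may later be adapted to the element at
  which the transfer is evaluated.\<close>

lemma transfer_sum_additive:
  assumes H: "subgroup H G" and f: "additive_mod n H f"
    and s: "\<And>C. C \<in> rcosets H \<Longrightarrow> s C \<in> C"
  shows "additive_mod n (carrier G) (transfer_sum H s f)"
  unfolding additive_mod_def
proof (intro ballI)
  fix g h assume gh: "g \<in> carrier G" "h \<in> carrier G"
  let ?c = "\<lambda>C g. s C \<otimes> g \<otimes> inv (s (C #> g))"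
  have sub: "C \<subseteq> carrier G" if "C \<in> rcosets H" for C
    using that H by (rule rcosets_subset_carrier[rotated])
  have sG: "s C \<in> carrier G" if "C \<in> rcosets H" for C using that s sub by blast
  note tr = rcoset_translate[OF H]
  have cH: "?c C g \<in> H" if "C \<in> rcosets H" "g \<in> carrier G" for C g
  proof (rule rcoset_quotient[OF H tr[OF that]])
    show "s C \<otimes> g \<in> C #> g" using s[OF that(1)] by (auto simp: r_coset_def)
    show "s (C #> g) \<in> C #> g" using s tr that by blast
  qed
  have "[(\<Sum>C\<in>rcosets H. f (?c C (g \<otimes> h))) = (\<Sum>C\<in>rcosets H. f (?c C g) + f (?c (C #> g) h))] (mod n)"
  proof (rule cong_sum)
    fix C assume C: "C \<in> rcosets H"
    have Cgh: "C #> (g \<otimes> h) = C #> g #> h" using sub[OF C] gh by (simp add: coset_mult_assoc)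
    have "?c C (g \<otimes> h) = ?c C g \<otimes> ?c (C #> g) h"
      unfolding Cgh using sG[OF C] sG[OF tr[OF C gh(1)]] sG[OF tr[OF tr[OF C gh(1)] gh(2)]] gh
      by (simp add: m_assoc)
    then show "[f (?c C (g \<otimes> h)) = f (?c C g) + f (?c (C #> g) h)] (mod n)"
      using additive_modD[OF f cH[OF C gh(1)] cH[OF tr[OF C gh(1)] gh(2)]] by simp
  qed
  also have "(\<Sum>C\<in>rcosets H. f (?c C g) + f (?c (C #> g) h)) =
      (\<Sum>C\<in>rcosets H. f (?c C g)) + (\<Sum>C\<in>rcosets H. f (?c (C #> g) h))"
    by (rule sum.distrib)
  also have "(\<Sum>C\<in>rcosets H. f (?c (C #> g) h)) = (\<Sum>C\<in>rcosets H. f (?c C h))"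
  proof (rule sum.reindex_bij_betw)
    show "bij_betw (\<lambda>C. C #> g) (rcosets H) (rcosets H)"
      by (rule bij_betw_byWitness[where f' = "\<lambda>C. C #> inv g"])
         (use tr gh(1) sub in \<open>auto simp: coset_mult_assoc\<close>)
  qed
  finally show "[transfer_sum H s f (g \<otimes> h) = transfer_sum H s f g + transfer_sum H s f h] (mod n)"
    by (simp add: transfer_sum_def)
qed

text \<open>In each orbit of the powers of \<open>u\<close> on the cosets choose a base coset \<open>Ht\<close>, and represent a coset \<open>Htu\<^sup>k\<close> by
  \<open>tu\<^sup>k\<close> for one chosen exponent \<open>k\<close>. Every contribution to the transfer of \<open>u\<close> is then a conjugate of a power
  of \<open>u\<close>. The last clause holds because a fixed base coset is its whole orbit.\<close>

lemma adapted_section: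
  assumes H: "subgroup H G" and u: "u \<in> carrier G"
  obtains s where "\<And>C. C \<in> rcosets H \<Longrightarrow> s C \<in> C"
    "\<And>C. C \<in> rcosets H \<Longrightarrow> \<exists>t\<in>carrier G. \<exists>m::int.
        s C \<otimes> u \<otimes> inv (s (C #> u)) = t \<otimes> u [^] m \<otimes> inv t \<and>
        (C #> u = C \<longrightarrow> m = 1) \<and> (H #> t #> u = H #> t \<longrightarrow> C #> u = C)"
proof -
  interpret H: subgroup H G by fact
  define orb where "orb C = {C #> u [^] (i::int) | i. True}" for C
  define b where "b C = (SOME D. D \<in> orb C)" for C
  define k where "k C = (SOME i::int. C = b C #> u [^] i)" for C
  define t where "t D = (SOME x. x \<in> D)" for D :: "'a set"
  define s where "s C = t (b C) \<otimes> u [^] (k C)" for C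
  have sub: "C \<subseteq> carrier G" if "C \<in> rcosets H" for C
    using that H by (rule rcosets_subset_carrier[rotated])
  note tr = rcoset_translate[OF H]
  have orb_u: "orb (C #> u) = orb C" if C: "C \<in> rcosets H" for C
  proof -
    have 1: "C #> u #> u [^] i = C #> u [^] (i + 1)" for i :: int
      using sub[OF C] u int_pow_mult[OF u, of 1 i] by (simp add: coset_mult_assoc add.commute)
    have 2: "C #> u [^] i = C #> u #> u [^] (i - 1)" for i :: int
      using 1[of "i - 1"] by simp
    show ?thesis unfolding orb_def using 1 2 by blast
  qed
  have bC: "\<exists>i::int. C = b C #> u [^] i" "b C \<in> rcosets H" if C: "C \<in> rcosets H" for C
  proof -
    have "C #> u [^] (0::int) \<in> orb C" unfolding orb_def by blast
    then have "b C \<in> orb C" unfolding b_def by (rule someI)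
    then obtain i :: int where i: "b C = C #> u [^] i" by (auto simp: orb_def)
    have "b C #> u [^] (- i) = C"
      unfolding i using sub[OF C] u by (simp add: coset_mult_assoc flip: int_pow_mult)
    then show "\<exists>i::int. C = b C #> u [^] i" by metis
    show "b C \<in> rcosets H" unfolding i using C u by (intro tr) auto
  qed
  have kC: "C = b C #> u [^] (k C)" if C: "C \<in> rcosets H" for C
    unfolding k_def using bC(1)[OF C] by (rule someI_ex)
  have tD: "t D \<in> D" "t D \<in> carrier G" "H #> t D = D" if D: "D \<in> rcosets H" for D
  proof -
    obtain a where a: "a \<in> carrier G" "D = H #> a" using D by (auto simp: RCOSETS_def)
    then have "a \<in> D" using rcos_self H by blast
    then show "t D \<in> D" unfolding t_def by (rule someI)
    then show "t D \<in> carrier G" using sub D by blast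
    show "H #> t D = D" using \<open>t D \<in> D\<close> a H repr_independence by blast
  qed
  show thesis
  proof (rule that)
    fix C assume C: "C \<in> rcosets H"
    have "s C \<in> b C #> u [^] (k C)"
      using tD(1)[OF bC(2)[OF C]] by (auto simp: s_def r_coset_def)
    then show "s C \<in> C" using kC[OF C] by simp
    let ?t = "t (b C)" and ?m = "k C + 1 - k (C #> u)"
    have tG: "?t \<in> carrier G" using tD bC C by blast
    have b_u: "b (C #> u) = b C" by (simp add: b_def orb_u[OF C])
    have "u [^] (k C) \<otimes> u \<otimes> inv (u [^] (k (C #> u))) = u [^] ?m"
      using u int_pow_mult[OF u, of "k C" 1] by (simp add: int_pow_diff)
    moreover have "s C \<otimes> u \<otimes> inv (s (C #> u)) =
        ?t \<otimes> (u [^] (k C) \<otimes> u \<otimes> inv (u [^] (k (C #> u)))) \<otimes> inv ?t"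
      unfolding s_def b_u using tG u by (simp add: inv_mult_group m_assoc)
    ultimately have "s C \<otimes> u \<otimes> inv (s (C #> u)) = ?t \<otimes> u [^] ?m \<otimes> inv ?t" by simp
    moreover have "C #> u = C" if "H #> ?t #> u = H #> ?t"
    proof -
      have bu: "b C #> u = b C" using that tD(3)[OF bC(2)[OF C]] by simp
      have "C #> u = b C #> u [^] (k C) #> u" using kC[OF C] by simp
      also have "\<dots> = b C #> u #> u [^] (k C)"
        using sub[OF bC(2)[OF C]] u int_pow_mult[OF u, of "k C" 1] int_pow_mult[OF u, of 1 "k C"]
        by (simp add: coset_mult_assoc add.commute)
      also have "\<dots> = C" using bu kC[OF C] by simp
      finally show ?thesis .
    qed
    ultimately show "\<exists>t\<in>carrier G. \<exists>m::int.
        s C \<otimes> u \<otimes> inv (s (C #> u)) = t \<otimes> u [^] m \<otimes> inv t \<and>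
        (C #> u = C \<longrightarrow> m = 1) \<and> (H #> t #> u = H #> t \<longrightarrow> C #> u = C)"
      using tG by (intro bexI[of _ ?t] exI[of _ ?m]) auto
  qed
qed

end

context finite_group_at_prime
begin

text \<open>Take \<open>f\<close> nonzero modulo \<open>p\<close> on \<open>P\<close> and \<open>u\<close> with \<open>f u\<close> not divisible by \<open>p\<close>. By control of fusion a contribution
  \<open>tu\<^sup>mt\<inverse>\<close> has the value \<open>m \<cdot> f u\<close>. For cosets fixed by \<open>u\<close> this is \<open>f u\<close>; for the others \<open>p\<close> divides \<open>m\<close>,
  as otherwise \<open>u\<close> would be a power of \<open>u\<^sup>m\<close> and would fix the base coset. So the transfer of \<open>u\<close> is \<open>f u\<close> times
  the number of fixed cosets, which is congruent to the index of \<open>P\<close> and hence prime to \<open>p\<close>.\<close>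

lemma transfer_nontrivial:
  assumes P: "p_subgroup p P G" "P \<noteq> {\<one>}" "\<not> p dvd card (rcosets P)"
    and fusion: "\<And>u g. u \<in> P \<Longrightarrow> g \<in> carrier G \<Longrightarrow> u \<^bold>^ g \<in> P \<Longrightarrow> \<exists>x\<in>P. u \<^bold>^ g = u \<^bold>^ x"
  obtains \<tau> u where "additive_mod (int p) (carrier G) \<tau>" "u \<in> carrier G" "\<not> [\<tau> u = 0] (mod int p)"
proof -
  have PG: "subgroup P G" using P by (simp add: p_subgroup_def)
  interpret P: subgroup P G by fact
  obtain f u where fP: "additive_mod (int p) P f" and u: "u \<in> P" "\<not> [f u = 0] (mod int p)"
    using nonzero_additive_mod_exists[OF P(1,2)] by blast
  have uG: "u \<in> carrier G" using u by simp
  obtain e where e: "u [^] (p ^ e) = \<one>" using p_subgroup_pow[OF P(1)] u by metis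
  obtain s where s: "\<And>C. C \<in> rcosets P \<Longrightarrow> s C \<in> C"
    and su: "\<And>C. C \<in> rcosets P \<Longrightarrow> \<exists>t\<in>carrier G. \<exists>m::int.
        s C \<otimes> u \<otimes> inv (s (C #> u)) = t \<otimes> u [^] m \<otimes> inv t \<and>
        (C #> u = C \<longrightarrow> m = 1) \<and> (P #> t #> u = P #> t \<longrightarrow> C #> u = C)"
    using adapted_section[OF PG uG] by blast
  have pow_closed: "t \<otimes> u [^] i \<otimes> inv t \<in> P"
    if t: "t \<in> carrier G" "t \<otimes> u [^] j \<otimes> inv t \<in> P" "j dvd i" for t and i j :: int
  proof -
    obtain l where "i = j * l" using t(3) by blast
    then have "t \<otimes> u [^] i \<otimes> inv t = (t \<otimes> u [^] j \<otimes> inv t) [^] l"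
      using conj_int_pow[of "u [^] j" "inv t" l] t(1) uG by (simp add: conj_elt_def int_pow_pow)
    then show ?thesis using t(2) PG by (simp add: subgroup_int_pow_closed)
  qed
  have key: "[f (s C \<otimes> u \<otimes> inv (s (C #> u))) = (if C #> u = C then f u else 0)] (mod int p)"
    if C: "C \<in> rcosets P" for C
  proof -
    obtain t m where t: "t \<in> carrier G"
      and m: "s C \<otimes> u \<otimes> inv (s (C #> u)) = t \<otimes> u [^] (m::int) \<otimes> inv t"
      and m1: "C #> u = C \<longrightarrow> m = 1" and fix_base: "P #> t #> u = P #> t \<longrightarrow> C #> u = C"
      using su[OF C] by blast
    have tmP: "t \<otimes> u [^] m \<otimes> inv t \<in> P"
      unfolding m[symmetric]
    proof (rule rcoset_quotient[OF PG rcoset_translate[OF PG C uG]])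
      show "s C \<otimes> u \<in> C #> u" using s[OF C] by (auto simp: r_coset_def)
      show "s (C #> u) \<in> C #> u" using s rcoset_translate[OF PG C uG] .
    qed
    have umP: "u [^] m \<in> P" using u PG by (simp add: subgroup_int_pow_closed)
    have conj: "t \<otimes> u [^] m \<otimes> inv t = (u [^] m) \<^bold>^ (inv t)" using t by (simp add: conj_elt_def)
    obtain x where x: "x \<in> P" "(u [^] m) \<^bold>^ (inv t) = (u [^] m) \<^bold>^ x"
      using fusion[OF umP, of "inv t"] t tmP conj by auto
    have "[f (s C \<otimes> u \<otimes> inv (s (C #> u))) = f (u [^] m)] (mod int p)"
      unfolding m conj x(2) using PG fP umP x(1) by (rule additive_mod_conj)
    also have "[f (u [^] m) = m * f u] (mod int p)" using PG fP u(1) by (rule additive_mod_int_pow)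
    also have "[m * f u = (if C #> u = C then f u else 0)] (mod int p)"
    proof (cases "C #> u = C")
      case True
      then show ?thesis using m1 by simp
    next
      case False
      (* Otherwise u = (u^m)^a by Bezout, because the order of u is a power of p. *)
      have "int p dvd m"
      proof (rule ccontr)
        assume "\<not> int p dvd m"
        then have "coprime (int p) m" using prime_p by (simp add: prime_imp_coprime)
        then have "coprime m (int (p ^ e))" by (simp add: coprime_commute)
        then obtain a b where ab: "a * m + b * int (p ^ e) = 1"
          using bezout_int[of m "int (p ^ e)"] by auto
        have ue: "u [^] (int (p ^ e)) = \<one>" using e by (simp only: int_pow_int)
        have "m * a = 1 - int (p ^ e) * b"
          using ab by (metis add_diff_cancel_right' mult.commute)
        then have "u [^] (m * a) = u [^] (1 - int (p ^ e) * b)" by (simp only:)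
        also have "\<dots> = u"
          using uG ue by (simp add: int_pow_diff int_pow_pow[symmetric] del: of_nat_power)
        finally have "t \<otimes> u \<otimes> inv t \<in> P" using pow_closed[OF t tmP, of "m * a"] by simp
        then show False using rcoset_fixed_iff[OF PG t uG] fix_base False by blast
      qed
      then show ?thesis using False by (simp add: cong_iff_dvd_diff)
    qed
    finally show ?thesis .
  qed
  let ?F = "{C \<in> rcosets P. C #> u = C}"
  have finR: "finite (rcosets P)" using PG by (simp add: finite_rcosets)
  have "[transfer_sum P s f u = (\<Sum>C\<in>rcosets P. if C #> u = C then f u else 0)] (mod int p)"
    unfolding transfer_sum_def by (rule cong_sum) (rule key)
  also have "(\<Sum>C\<in>rcosets P. if C #> u = C then f u else 0) = int (card ?F) * f u"
    using finR by (simp add: sum.If_cases Collect_conj_eq[symmetric] Int_def)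
  finally have tu: "[transfer_sum P s f u = int (card ?F) * f u] (mod int p)" .
  let ?R = "generate G {u}"
  have RG: "subgroup ?R G" "?R \<subseteq> P"
    using uG u(1) PG generate_subgroup_incl[of "{u}" P] by (auto intro!: generate_is_subgroup)
  have R: "?R = {u [^] (i::int) | i. True}" using generate_pow[OF uG] by auto
  have "{C \<in> rcosets P. \<forall>r\<in>?R. C #> r = C} = ?F"
  proof -
    have "(\<forall>r\<in>?R. C #> r = C) \<longleftrightarrow> C #> u = C" if C: "C \<in> rcosets P" for C
    proof
      assume "\<forall>r\<in>?R. C #> r = C"
      moreover have "u \<in> ?R" by (simp add: generate.incl)
      ultimately show "C #> u = C" by blast
    next
      assume Cu: "C #> u = C"
      obtain x where x: "x \<in> carrier G" "C = P #> x" using C by (auto simp: RCOSETS_def)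
      have "x \<otimes> u [^] (1::int) \<otimes> inv x \<in> P"
        using rcoset_fixed_iff[OF PG x(1) uG] Cu x uG by simp
      then have "x \<otimes> u [^] i \<otimes> inv x \<in> P" for i :: int
        using pow_closed[OF x(1)] one_dvd by blast
      then have "C #> u [^] i = C" for i :: int
        unfolding x(2) using rcoset_fixed_iff[OF PG x(1)] uG by blast
      then show "\<forall>r\<in>?R. C #> r = C" unfolding R by blast
    qed
    then show ?thesis by blast
  qed
  then have "[card (rcosets P) = card ?F] (mod p)"
    using fixed_cosets_cong[OF PG p_subgroup_mono[OF P(1) RG]] by simp
  then have "\<not> p dvd card ?F" using P(3) cong_dvd_iff by blast
  have "\<not> int p dvd int (card ?F) * f u"
  proof
    assume "int p dvd int (card ?F) * f u"
    then have "int p dvd int (card ?F) \<or> int p dvd f u"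
      using prime_p by (simp add: prime_dvd_mult_iff)
    then show False using \<open>\<not> p dvd card ?F\<close> u(2) by (simp add: cong_0_iff)
  qed
  then have "\<not> [transfer_sum P s f u = 0] (mod int p)"
    using tu by (simp add: cong_0_iff cong_dvd_iff)
  then show thesis using that transfer_sum_additive[OF PG fP s] uG by blast
qed

end

section \<open>Frobenius' criterion\<close>

context finite_group_at_prime
begin

text \<open>The subgroup is the kernel of the transfer into the integers modulo \<open>p\<close>, where \<open>0\<close> is the only element of
  order prime to \<open>p\<close>.\<close>

lemma proper_subgroup_with_p_regular_elements:
  assumes reg: "p_regular_elements_centralize p G" and dvd: "p dvd order G"
  obtains K where "subgroup K G" "K \<subset> carrier G"
    "\<And>x. x \<in> carrier G \<Longrightarrow> coprime (ord x) p \<Longrightarrow> x \<in> K"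
proof -
  obtain P where P: "subgroup P G" "card P = p ^ multiplicity p (order G)"
    "\<not> p dvd order G div card P"
    using sylow_exists[OF prime_p] by blast
  have pP: "p_subgroup p P G" using P by (auto simp: p_subgroup_def)
  have "P \<noteq> {\<one>}" using dvd P(3) by auto
  have Pi: "\<not> p dvd card (rcosets P)" using P(1,3) by (simp add: card_rcosets_eq_div)
  have fusion: "\<exists>x\<in>P. u \<^bold>^ g = u \<^bold>^ x" if u: "u \<in> P" "g \<in> carrier G" "u \<^bold>^ g \<in> P" for u g
  proof -
    have uG: "u \<in> carrier G" using u(1) P(1) by (meson subgroup.mem_carrier)
    have "\<exists>x\<in>P. \<forall>a\<in>generate G {u}. a \<^bold>^ g = a \<^bold>^ x"
    proof (rule sylow_controls_fusion[OF reg pP P(3)])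
      show "a \<^bold>^ g \<in> P" if "a \<in> generate G {u}" for a
        using that generate_pow[OF uG] u uG P(1) by (auto simp: conj_int_pow subgroup_int_pow_closed)
    qed (use u uG P(1) generate_subgroup_incl[of "{u}" P] in \<open>auto intro!: generate_is_subgroup\<close>)
    moreover have "u \<in> generate G {u}" by (simp add: generate.incl)
    ultimately show ?thesis by blast
  qed
  obtain \<tau> u where \<tau>: "additive_mod (int p) (carrier G) \<tau>"
    and u: "u \<in> carrier G" "\<not> [\<tau> u = 0] (mod int p)"
    using transfer_nontrivial[OF pP \<open>P \<noteq> {\<one>}\<close> Pi fusion] by blast
  define K where "K = {x \<in> carrier G. [\<tau> x = 0] (mod int p)}"
  have KG: "subgroup K G" unfolding K_def using subgroup_self \<tau> by (rule additive_mod_kernel)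
  have reg_K: "x \<in> K" if x: "x \<in> carrier G" "coprime (ord x) p" for x
  proof -
    have "[\<tau> (x [^] ord x) = int (ord x) * \<tau> x] (mod int p)"
      using subgroup_self \<tau> x(1) by (rule additive_mod_nat_pow)
    then have "[int (ord x) * \<tau> x = 0] (mod int p)"
      using additive_mod_one[OF subgroup_self \<tau>] x(1) cong_sym cong_trans by fastforce
    then have "int p dvd int (ord x) * \<tau> x" by (simp add: cong_0_iff)
    then have "int p dvd \<tau> x" using x(2) by (simp add: coprime_commute coprime_dvd_mult_right_iff)
    then show ?thesis using x(1) by (simp add: K_def cong_0_iff)
  qed
  have "K \<subset> carrier G" using u by (auto simp: K_def)
  then show thesis using that KG reg_K by blast
qed

lemma p_regular_elements_centralize_subgroup:
  assumes "p_regular_elements_centralize p G" "subgroup K G"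
  shows "p_regular_elements_centralize p (G\<lparr>carrier := K\<rparr>)"
  unfolding p_regular_elements_centralize_def
proof (intro allI impI ballI)
  fix Q g a
  let ?K = "G\<lparr>carrier := K\<rparr>"
  assume "p_subgroup p Q ?K \<and> g \<in> carrier ?K \<and> coprime (group.ord ?K g) p \<and>
    (\<forall>a\<in>Q. conj_elt ?K a g \<in> Q)" and a: "a \<in> Q"
  then have "p_subgroup p Q G" "g \<in> K" "coprime (ord g) p" "\<forall>a\<in>Q. a \<^bold>^ g \<in> Q"
    using assms(2) by (auto simp: p_subgroup_def subgroup_restrict_iff ord_subgroup conj_elt_subgroup)
  moreover from this have "g \<in> carrier G" using assms(2) by (meson subgroup.mem_carrier)
  ultimately have "a \<^bold>^ g = a"
    using assms(1) a unfolding p_regular_elements_centralize_def by blast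
  then show "conj_elt ?K a g = a" using \<open>g \<in> K\<close> assms(2) by (simp add: conj_elt_subgroup)
qed

end

text \<open>Induction on the order: if \<open>p\<close> divides it, the proper subgroup \<open>K\<close> supplied by
  \<open>proper_subgroup_with_p_regular_elements\<close> inherits the hypothesis and has the same p-regular elements as \<open>G\<close>.\<close>

theorem frobenius_p_nilpotency_criterion:
  assumes "finite_group_at_prime G p" "p_regular_elements_centralize p G"
  shows "subgroup {x \<in> carrier G. coprime (group.ord G x) p} G"
  using assms
proof (induction "order G" arbitrary: G rule: less_induct)
  case (less G)
  interpret finite_group_at_prime G p by (rule less.prems)
  show ?case
  proof (cases "p dvd order G")
    case False
    have "coprime (ord x) p" if "x \<in> carrier G" for x
      using that False ord_dvd_group_order prime_p
      by (metis coprime_commute dvd_trans prime_imp_coprime)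
    then have "{x \<in> carrier G. coprime (ord x) p} = carrier G" by blast
    then show ?thesis using subgroup_self by simp
  next
    case True
    obtain K where K: "subgroup K G" "K \<subset> carrier G"
      and reg_K: "\<And>x. x \<in> carrier G \<Longrightarrow> coprime (ord x) p \<Longrightarrow> x \<in> K"
      using proper_subgroup_with_p_regular_elements[OF less.prems(2) True] by blast
    interpret K: finite_group_at_prime "G\<lparr>carrier := K\<rparr>" p
      using K(1) by (rule subgroup_at_prime)
    have "order (G\<lparr>carrier := K\<rparr>) < order G"
      using K(2) by (simp add: order_def psubset_card_mono)
    then have "subgroup {x \<in> K. coprime (K.ord x) p} (G\<lparr>carrier := K\<rparr>)"
      using less.hyps[of "G\<lparr>carrier := K\<rparr>"] K.finite_group_at_prime_axioms
        p_regular_elements_centralize_subgroup[OF less.prems(2) K(1)] by simp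
    moreover have "{x \<in> K. coprime (K.ord x) p} = {x \<in> carrier G. coprime (ord x) p}"
      using reg_K K by (auto simp: ord_subgroup)
    ultimately show ?thesis using K(1) by (simp add: subgroup_restrict_iff)
  qed
qed

section \<open>p-regular automorphisms of p-groups\<close>

context group
begin

lemma commutator_power:
  assumes xy: "x \<in> carrier G" "y \<in> carrier G" "c \<in> carrier G"
    and c: "y \<otimes> x = x \<otimes> y \<otimes> c" and cx: "c \<otimes> x = x \<otimes> c" and cy: "c \<otimes> y = y \<otimes> c"
  shows "y [^] (n::nat) \<otimes> x = x \<otimes> y [^] n \<otimes> c [^] n"
proof (induction n)
  case (Suc n)
  have "y [^] Suc n \<otimes> x = y [^] n \<otimes> (y \<otimes> x)" using xy by (simp add: m_assoc)
  also have "\<dots> = (y [^] n \<otimes> x) \<otimes> (y \<otimes> c)" using xy by (simp add: c m_assoc)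
  also have "\<dots> = x \<otimes> y [^] n \<otimes> (c [^] n \<otimes> y) \<otimes> c" using xy by (simp add: Suc.IH m_assoc)
  also have "c [^] n \<otimes> y = y \<otimes> c [^] n" using group_commutes_pow[OF cy] xy by blast
  finally show ?case using xy by (simp add: m_assoc)
qed (use xy in simp)

text \<open>The power formula in class two: \<open>c\<close> is the commutator of \<open>y\<close> and \<open>x\<close>, and it is central in the group
  generated by \<open>x\<close> and \<open>y\<close>.\<close>

lemma power_of_product:
  assumes xy: "x \<in> carrier G" "y \<in> carrier G" "c \<in> carrier G"
    and c: "y \<otimes> x = x \<otimes> y \<otimes> c" and cx: "c \<otimes> x = x \<otimes> c" and cy: "c \<otimes> y = y \<otimes> c"
  shows "(x \<otimes> y) [^] (n::nat) = x [^] n \<otimes> y [^] n \<otimes> c [^] (n choose 2)"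
proof (induction n)
  case (Suc n)
  let ?t = "n choose 2"
  have ct: "c [^] k \<otimes> x = x \<otimes> c [^] k" "c [^] k \<otimes> y = y \<otimes> c [^] k" for k :: nat
    using group_commutes_pow[OF cx] group_commutes_pow[OF cy] xy by blast+
  have "(x \<otimes> y) [^] Suc n = x [^] n \<otimes> y [^] n \<otimes> (c [^] ?t \<otimes> x) \<otimes> y"
    using xy by (simp add: Suc.IH m_assoc)
  also have "\<dots> = x [^] n \<otimes> (y [^] n \<otimes> x) \<otimes> (c [^] ?t \<otimes> y)"
    unfolding ct(1) using xy by (simp add: m_assoc)
  also have "\<dots> = x [^] n \<otimes> (x \<otimes> y [^] n \<otimes> c [^] n) \<otimes> (y \<otimes> c [^] ?t)"
    unfolding ct(2) commutator_power[OF assms] ..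
  also have "\<dots> = x [^] n \<otimes> x \<otimes> y [^] n \<otimes> (c [^] n \<otimes> y) \<otimes> c [^] ?t"
    using xy by (simp add: m_assoc)
  also have "\<dots> = x [^] Suc n \<otimes> y [^] Suc n \<otimes> (c [^] n \<otimes> c [^] ?t)"
    unfolding ct(2) using xy by (simp add: m_assoc)
  also have "c [^] n \<otimes> c [^] ?t = c [^] (Suc n choose 2)"
    using xy by (simp add: nat_pow_mult numeral_2_eq_2)
  finally show ?case .
qed (use xy in \<open>simp add: numeral_2_eq_2\<close>)

end

context finite_group_at_prime
begin

text \<open>If \<open>g\<close> fixes the commutator \<open>w = x\<inverse>x\<^sup>g\<close>, then conjugation by the \<open>n\<close>-th power of \<open>g\<close> maps \<open>x\<close> to
  \<open>xw\<^sup>n\<close>. So the order of \<open>w\<close> divides that of \<open>g\<close>; being a p-element, \<open>w\<close> is trivial.\<close>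

lemma coprime_action_trivial:
  assumes x: "x \<in> carrier G" and g: "g \<in> carrier G" "coprime (ord g) p"
    and fixed: "(inv x \<otimes> x \<^bold>^ g) \<^bold>^ g = inv x \<otimes> x \<^bold>^ g"
    and p_power: "(inv x \<otimes> x \<^bold>^ g) [^] (p ^ k) = \<one>"
  shows "x \<^bold>^ g = x"
proof -
  define w where "w = inv x \<otimes> x \<^bold>^ g"
  have wG: "w \<in> carrier G" using x g by (simp add: w_def)
  have xg: "x \<^bold>^ g = x \<otimes> w" using x g by (simp add: w_def)
  have wg: "w \<^bold>^ g = w" using fixed by (simp add: w_def)
  have iter: "x \<^bold>^ (g [^] n) = x \<otimes> w [^] n" for n :: nat
  proof (induction n)
    case (Suc n)
    have "x \<^bold>^ (g [^] Suc n) = x \<^bold>^ (g [^] n) \<^bold>^ g" using x g by (simp add: conj_conj)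
    also have "\<dots> = x \<^bold>^ g \<otimes> w [^] n"
      unfolding Suc.IH using x g wG wg by (simp add: conj_mult conj_pow)
    also have "\<dots> = x \<otimes> w [^] Suc n"
      unfolding xg using x wG nat_pow_Suc2[OF wG, of n] by (simp add: m_assoc)
    finally show ?case .
  qed (use x in simp)
  have "x = x \<otimes> w [^] ord g" using iter[of "ord g"] x g by simp
  then have "w [^] ord g = \<one>" using x wG by simp
  then have "ord w dvd ord g" using wG pow_eq_id by blast
  then have "coprime (ord w) p" using g(2) by (rule coprime_divisors[OF _ dvd_refl])
  then have "w = \<one>" using ord_coprime_imp_trivial[OF wG] p_power by (simp add: w_def)
  then show ?thesis using xg x by simp
qed

text \<open>No proper \<open>g\<close>-invariant subgroup contains all commutators \<open>x\<inverse>x\<^sup>g\<close>: by minimality they would be fixed by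
  \<open>g\<close>, and \<open>g\<close> would act trivially. This is used twice. There is a proper \<open>g\<close>-invariant \<open>R\<close> with \<open>Q/R\<close> elementary
  abelian, and \<open>g\<close> centralizes \<open>R\<close>. As in the three subgroups lemma, the centralizer of \<open>R\<close> in \<open>Q\<close> contains
  all \<open>x\<inverse>x\<^sup>g\<close>, so \<open>R\<close> is central. Then \<open>Q\<close> has class at most two, and the power map with exponent \<open>p\<close>
  (or \<open>4\<close>) is a homomorphism from \<open>Q\<close> to \<open>R\<close> commuting with the action of \<open>g\<close>. Its kernel contains all
  \<open>x\<inverse>x\<^sup>g\<close> because \<open>g\<close> fixes its values.\<close>

lemma exponent_of_minimal_action:
  assumes Q: "p_subgroup p Q G" and g: "g \<in> carrier G" "coprime (ord g) p"
    and inv: "\<And>a. a \<in> Q \<Longrightarrow> a \<^bold>^ g \<in> Q" and nontriv: "\<exists>x\<in>Q. x \<^bold>^ g \<noteq> x"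
    and minimal: "\<And>R a. \<lbrakk>subgroup R G; R \<subset> Q; \<forall>a\<in>R. a \<^bold>^ g \<in> R; a \<in> R\<rbrakk> \<Longrightarrow> a \<^bold>^ g = a"
    and x: "x \<in> Q"
  shows "x [^] (if p = 2 then 4 else p) = \<one>"
proof -
  have QG: "subgroup Q G" using Q by (simp add: p_subgroup_def)
  interpret Q: subgroup Q G by fact
  obtain k where k: "\<And>x. x \<in> Q \<Longrightarrow> x [^] (p ^ k) = \<one>" using p_subgroup_pow[OF Q] by blast
  have conjQ: "a \<^bold>^ b \<in> Q" if "a \<in> Q" "b \<in> Q" for a b using that by (simp add: conj_elt_def)
  have whole: "D = Q"
    if D: "subgroup D G" "D \<subseteq> Q" "\<And>a. a \<in> D \<Longrightarrow> a \<^bold>^ g \<in> D"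
      "\<And>x. x \<in> Q \<Longrightarrow> inv x \<otimes> x \<^bold>^ g \<in> D" for D
  proof (rule ccontr)
    assume "D \<noteq> Q"
    then have "D \<subset> Q" using D(2) by blast
    have "x \<^bold>^ g = x" if x: "x \<in> Q" for x
    proof (rule coprime_action_trivial[OF _ g])
      show "(inv x \<otimes> x \<^bold>^ g) \<^bold>^ g = inv x \<otimes> x \<^bold>^ g"
        using minimal[OF D(1) \<open>D \<subset> Q\<close>] D(3,4) x by blast
      show "(inv x \<otimes> x \<^bold>^ g) [^] (p ^ k) = \<one>" using k x inv by simp
    qed (use x in simp)
    then show False using nontriv by blast
  qed
  have "Q \<noteq> {\<one>}" using nontriv g by auto
  then obtain f y where f: "additive_mod (int p) Q f" and y: "y \<in> Q" "\<not> [f y = 0] (mod int p)"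
    using nonzero_additive_mod_exists[OF Q] by blast
  note fconj = additive_mod_conj[OF QG f] and finv = additive_mod_inv[OF QG f]
  define K where "K = {x \<in> Q. [f x = 0] (mod int p)}"
  have KG: "subgroup K G" unfolding K_def using QG f by (rule additive_mod_kernel)
  interpret K: subgroup K G by fact
  have gn: "a \<^bold>^ (g [^] n) \<in> Q" if a: "a \<in> Q" for a and n :: nat
  proof (induction n)
    case (Suc n)
    have "a \<^bold>^ (g [^] Suc n) = a \<^bold>^ (g [^] n) \<^bold>^ g" using a g by (simp add: conj_conj)
    then show ?case using inv Suc by simp
  qed (use a in simp)
  have gG: "g [^] n \<in> carrier G" for n :: nat using g by simp
  (* The largest g-invariant subgroup of the kernel K of f. Since f takes values in an abelian group
     of exponent p, R contains all p-th powers and all commutators of Q. *)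
  define R where "R = {x \<in> Q. \<forall>n::nat. x \<^bold>^ (g [^] n) \<in> K}"
  have RQ: "R \<subseteq> Q" by (auto simp: R_def)
  have RG: "subgroup R G"
  proof (rule subgroupI)
    have "\<one> \<in> R" using gG by (simp add: R_def)
    then show "R \<noteq> {}" by blast
    show "inv a \<in> R" if "a \<in> R" for a using that gG by (simp add: R_def conj_inv)
    show "a \<otimes> b \<in> R" if "a \<in> R" "b \<in> R" for a b using that gG by (simp add: R_def conj_mult)
  qed (use RQ Q.subset in blast)
  interpret R: subgroup R G by fact
  have "y \<in> Q - R"
  proof -
    have "y \<^bold>^ (g [^] (0::nat)) \<notin> K" using y by (simp add: K_def)
    then show ?thesis using y(1) unfolding R_def by blast
  qed
  then have "R \<subset> Q" using RQ by blast
  have "a \<^bold>^ g \<in> R" if a: "a \<in> R" for a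
  proof -
    have eq: "a \<^bold>^ g \<^bold>^ (g [^] n) = a \<^bold>^ (g [^] Suc n)" for n :: nat
      using a g nat_pow_Suc2[OF g(1), of n] by (simp add: conj_conj)
    have "a \<^bold>^ g \<^bold>^ (g [^] n) \<in> K" for n :: nat
      unfolding eq using a unfolding R_def by blast
    then show ?thesis using a inv RQ unfolding R_def by blast
  qed
  then have fixR: "a \<^bold>^ g = a" if "a \<in> R" for a using minimal[OF RG \<open>R \<subset> Q\<close>] that by blast
  have pow_R: "a [^] p \<in> R" if a: "a \<in> Q" for a
  proof -
    have "(a [^] p) \<^bold>^ (g [^] n) \<in> K" for n :: nat
    proof -
      have "[f ((a \<^bold>^ (g [^] n)) [^] p) = int p * f (a \<^bold>^ (g [^] n))] (mod int p)"
        using QG f gn[OF a] by (rule additive_mod_nat_pow)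
      moreover have "[int p * f (a \<^bold>^ (g [^] n)) = 0] (mod int p)" by (simp add: cong_0_iff)
      ultimately have "[f ((a \<^bold>^ (g [^] n)) [^] p) = 0] (mod int p)" by (rule cong_trans)
      then show ?thesis
        using gn[OF a] QG a gG by (simp add: K_def conj_pow subgroup_nat_pow_closed)
    qed
    then show ?thesis using a QG by (simp add: R_def subgroup_nat_pow_closed)
  qed
  have comm_R: "inv a \<otimes> a \<^bold>^ b \<in> R" if a: "a \<in> Q" and b: "b \<in> Q" for a b
  proof -
    have "(inv a \<otimes> a \<^bold>^ b) \<^bold>^ (g [^] n) \<in> K" for n :: nat
    proof -
      let ?a = "a \<^bold>^ (g [^] n)" and ?b = "b \<^bold>^ (g [^] n)"
      have ab: "?a \<in> Q" "?b \<in> Q" using gn a b by auto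
      have "(inv a \<otimes> a \<^bold>^ b) \<^bold>^ (g [^] n) = inv ?a \<otimes> ?a \<^bold>^ ?b"
        using a b gG[of n] by (simp add: conj_elt_def m_assoc inv_mult_group)
      moreover have "[f (inv ?a \<otimes> ?a \<^bold>^ ?b) = f (inv ?a) + f (?a \<^bold>^ ?b)] (mod int p)"
        using ab conjQ by (intro additive_modD[OF f]) auto
      moreover have "[f (inv ?a) + f (?a \<^bold>^ ?b) = - f ?a + f ?a] (mod int p)"
        using ab by (intro cong_add fconj finv)
      ultimately show ?thesis
        using ab conjQ[OF ab] cong_trans by (fastforce simp: K_def)
    qed
    then show ?thesis using a b conjQ by (simp add: R_def)
  qed
  have normR: "a \<^bold>^ b \<in> R" if a: "a \<in> R" and b: "b \<in> Q" for a b
  proof -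
    have "a \<otimes> (inv a \<otimes> a \<^bold>^ b) \<in> R" using comm_R[of a b] a b RQ by blast
    then show ?thesis using a b by simp
  qed
  have fixR': "a \<^bold>^ (inv g) = a" if "a \<in> R" for a
    using fixR[OF that] conj_conj_inv(1)[of a g] that g by simp
  define D where "D = {x \<in> Q. \<forall>r\<in>R. r \<^bold>^ x = r}"
  have "D = Q"
  proof (rule whole)
    show "subgroup D G"
    proof (rule subgroupI)
      have "\<one> \<in> D" by (simp add: D_def)
      then show "D \<noteq> {}" by blast
      show "inv a \<in> D" if a: "a \<in> D" for a
      proof -
        have "r \<^bold>^ (inv a) = r" if r: "r \<in> R" for r
          using a r conj_conj_inv(1)[of r a] by (simp add: D_def)
        then show ?thesis using a by (simp add: D_def)
      qed
      show "a \<otimes> b \<in> D" if "a \<in> D" "b \<in> D" for a b using that by (simp add: D_def flip: conj_conj)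
    qed (auto simp: D_def)
    show "D \<subseteq> Q" by (auto simp: D_def)
    show "a \<^bold>^ g \<in> D" if a: "a \<in> D" for a
    proof -
      have aQ: "a \<in> Q" using a by (simp add: D_def)
      have "r \<^bold>^ (a \<^bold>^ g) = r" if r: "r \<in> R" for r
      proof -
        have "r \<^bold>^ (a \<^bold>^ g) = r \<^bold>^ (inv g) \<^bold>^ a \<^bold>^ g"
          using r aQ g by (simp add: conj_elt_def m_assoc inv_mult_group)
        also have "\<dots> = r" using r a by (simp add: fixR fixR' D_def)
        finally show ?thesis .
      qed
      then show ?thesis using aQ inv by (simp add: D_def)
    qed
    show "inv z \<otimes> z \<^bold>^ g \<in> D" if z: "z \<in> Q" for z
    proof -
      have "r \<^bold>^ (inv z \<otimes> z \<^bold>^ g) = r" if r: "r \<in> R" for r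
      proof -
        let ?r = "r \<^bold>^ (inv z)"
        have r': "?r \<in> R" using normR r z by simp
        have "r \<^bold>^ (inv z \<otimes> z \<^bold>^ g) = ?r \<^bold>^ (inv g) \<^bold>^ z \<^bold>^ g"
          using r z g by (simp add: conj_elt_def m_assoc inv_mult_group)
        also have "\<dots> = ?r \<^bold>^ z \<^bold>^ g" using fixR'[OF r'] by simp
        also have "\<dots> = r" using r z by (simp add: fixR)
        finally show ?thesis .
      qed
      then show ?thesis using z inv by (simp add: D_def)
    qed
  qed
  then have central: "r \<otimes> a = a \<otimes> r" if "r \<in> R" "a \<in> Q" for r a
  proof -
    have "a \<in> D" using that(2) \<open>D = Q\<close> by simp
    then have "r \<^bold>^ a = r" using that(1) by (simp add: D_def)
    then show ?thesis using that conj_fix_iff[of r a] by simp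
  qed
  define e where "e = (if p = 2 then 4 else p)"
  (* For p = 2 the exponent 2 would not do: the commutator enters with exponent 2 choose 2 = 1. *)
  have p_e: "p dvd e" "p dvd e choose 2"
  proof -
    show "p dvd e" by (simp add: e_def)
    show "p dvd e choose 2"
    proof (cases "p = 2")
      case True
      have "(4::nat) choose 2 = 6" by (simp add: choose_two)
      then show ?thesis using True by (simp add: e_def)
    next
      case False
      then have "2 < p" using prime_p prime_ge_2_nat[of p] by simp
      then show ?thesis using False prime_p by (auto simp: e_def intro: dvd_choose_prime)
    qed
  qed
  have pow_e_R: "a [^] e \<in> R" if a: "a \<in> Q" for a
  proof -
    obtain m where "e = p * m" using p_e by blast
    then have "a [^] e = (a [^] p) [^] m" using a by (simp add: nat_pow_pow)
    then show ?thesis using pow_R[OF a] RG by (simp add: subgroup_nat_pow_closed)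
  qed
  have pow_e_mult: "(a \<otimes> b) [^] e = a [^] e \<otimes> b [^] e" if a: "a \<in> Q" and b: "b \<in> Q" for a b
  proof -
    define c where "c = inv b \<otimes> b \<^bold>^ a"
    have c: "c \<in> R" unfolding c_def using comm_R a b by blast
    have ba: "b \<otimes> a = a \<otimes> b \<otimes> c" using a b by (simp add: c_def conj_elt_def m_assoc)
    have abG: "a \<in> carrier G" "b \<in> carrier G" "c \<in> carrier G" using a b c by auto
    note ass = abG ba central[OF c a] central[OF c b]
    have "a \<otimes> b [^] p = a \<otimes> b [^] p \<otimes> c [^] p"
      using commutator_power[OF ass, of p] central[OF pow_R[OF b] a] by simp
    then have cp: "c [^] p = \<one>" using abG by simp
    obtain m where "e choose 2 = p * m" using p_e by blast
    then have "c [^] (e choose 2) = (c [^] p) [^] m" using abG by (simp add: nat_pow_pow)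
    then show ?thesis using power_of_product[OF ass, of e] abG cp by simp
  qed
  have "{a \<in> Q. a [^] e = \<one>} = Q"
  proof (rule whole)
    show "subgroup {a \<in> Q. a [^] e = \<one>} G"
    proof (rule subgroupI)
      have "\<one> \<in> {a \<in> Q. a [^] e = \<one>}" by simp
      then show "{a \<in> Q. a [^] e = \<one>} \<noteq> {}" by blast
    qed (auto simp: pow_e_mult nat_pow_inv)
    show "a \<^bold>^ g \<in> {a \<in> Q. a [^] e = \<one>}" if "a \<in> {a \<in> Q. a [^] e = \<one>}" for a
      using that inv g by (auto simp flip: conj_pow)
    show "inv z \<otimes> z \<^bold>^ g \<in> {a \<in> Q. a [^] e = \<one>}" if z: "z \<in> Q" for z
    proof -
      have "(inv z \<otimes> z \<^bold>^ g) [^] e = (inv z) [^] e \<otimes> (z \<^bold>^ g) [^] e"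
        using z inv by (intro pow_e_mult) auto
      also have "(z \<^bold>^ g) [^] e = z [^] e"
        using z g fixR[OF pow_e_R[OF z]] by (simp flip: conj_pow)
      finally show ?thesis using z inv by (simp add: nat_pow_inv)
    qed
  qed auto
  then show ?thesis using x unfolding e_def by blast
qed

text \<open>In a minimal counterexample all of \<open>Q\<close> satisfies the exponent condition, so each \<open>a \<in> Q\<close> is moved by \<open>g\<close> as by
  some \<open>x \<in> P\<close>. Among the normal subgroups \<open>L\<close> of \<open>P\<close> such that \<open>g\<close> centralizes \<open>Q \<inter> L\<close> take a maximal
  one. If \<open>L \<noteq> P\<close>, let \<open>M/L\<close> be the centre of \<open>P/L\<close>. For \<open>a \<in> Q \<inter> M\<close> the commutator \<open>a\<inverse>a\<^sup>g = a\<inverse>a\<^sup>x\<close> lies in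
  \<open>Q \<inter> L\<close> and is fixed by \<open>g\<close>, so \<open>a\<close> is fixed by \<open>coprime_action_trivial\<close>. Thus \<open>M\<close> contradicts the
  maximality of \<open>L\<close>.\<close>

lemma p_regular_centralizes_if_small_fusion:
  assumes P: "p_subgroup p P G" and Q: "subgroup Q G" "Q \<subseteq> P"
    and g: "g \<in> carrier G" "coprime (ord g) p" and inv: "\<And>a. a \<in> Q \<Longrightarrow> a \<^bold>^ g \<in> Q"
    and fusion: "\<And>a. \<lbrakk>a \<in> Q; a [^] (if p = 2 then 4 else p) = \<one>\<rbrakk> \<Longrightarrow> \<exists>x\<in>P. a \<^bold>^ g = a \<^bold>^ x"
  shows "\<forall>a\<in>Q. a \<^bold>^ g = a"
  using Q inv fusion
proof (induction "card Q" arbitrary: Q rule: less_induct)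
  case (less Q)
  note Q = less.prems(1,2) and inv = less.prems(3) and fusion = less.prems(4)
  have PG: "subgroup P G" using P by (simp add: p_subgroup_def)
  interpret P: subgroup P G by fact
  interpret Q: subgroup Q G by (rule Q)
  have pQ: "p_subgroup p Q G" using P Q by (rule p_subgroup_mono)
  obtain k where k: "\<And>x. x \<in> Q \<Longrightarrow> x [^] (p ^ k) = \<one>" using p_subgroup_pow[OF pQ] by blast
  show ?case
  proof (rule ccontr)
    assume nontriv: "\<not> (\<forall>a\<in>Q. a \<^bold>^ g = a)"
    have minimal: "a \<^bold>^ g = a" if R: "subgroup R G" "R \<subset> Q" "\<forall>a\<in>R. a \<^bold>^ g \<in> R" "a \<in> R" for R a
    proof -
      have "card R < card Q" using R(2) Q by (simp add: psubset_card_mono subgroup_finite)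
      then have "\<forall>a\<in>R. a \<^bold>^ g = a"
        using R Q fusion by (intro less.hyps) auto
      then show ?thesis using R(4) by blast
    qed
    have fus: "\<exists>x\<in>P. a \<^bold>^ g = a \<^bold>^ x" if a: "a \<in> Q" for a
    proof -
      have "a [^] (if p = 2 then 4 else p) = \<one>"
      proof (rule exponent_of_minimal_action[OF pQ g inv _ _ a])
        show "\<exists>x\<in>Q. x \<^bold>^ g \<noteq> x" using nontriv by blast
        show "b \<^bold>^ g = b" if "subgroup R G" "R \<subset> Q" "\<forall>a\<in>R. a \<^bold>^ g \<in> R" "b \<in> R" for R b
          using that by (rule minimal)
      qed
      then show ?thesis using fusion a by blast
    qed
    define S where "S = {L. subgroup L G \<and> L \<subseteq> P \<and> (\<forall>a\<in>L. \<forall>x\<in>P. a \<^bold>^ x \<in> L) \<and>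
      (\<forall>a\<in>Q \<inter> L. a \<^bold>^ g = a)}"
    have finP: "finite P" using PG by (simp add: subgroup_finite)
    have "S \<subseteq> Pow P" unfolding S_def by blast
    then have "finite S" using finP by (simp add: finite_subset)
    moreover have "{\<one>} \<in> S" unfolding S_def using g(1) triv_subgroup by simp
    then have "S \<noteq> {}" by blast
    ultimately obtain L where L: "L \<in> S" "\<forall>M\<in>S. L \<subseteq> M \<longrightarrow> L = M"
      using finite_has_maximal[of S] by blast
    have LG: "subgroup L G" and LP: "L \<subseteq> P" and norm: "\<And>a x. a \<in> L \<Longrightarrow> x \<in> P \<Longrightarrow> a \<^bold>^ x \<in> L"
      and triv: "\<And>a. a \<in> Q \<Longrightarrow> a \<in> L \<Longrightarrow> a \<^bold>^ g = a"
      using L(1) unfolding S_def by blast+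
    interpret L: subgroup L G by fact
    have "L \<subset> P" using LP triv nontriv Q(2) by blast
    then obtain b where b: "b \<in> P - L" "\<forall>x\<in>P. inv b \<otimes> b \<^bold>^ x \<in> L"
      using central_element_modulo_normal[OF P LG _ norm] by blast
    define M where "M = {a \<in> P. \<forall>x\<in>P. inv a \<otimes> a \<^bold>^ x \<in> L}"
    have LM: "L \<subseteq> M" using LP norm by (auto simp: M_def)
    have bM: "b \<in> M" using b by (simp add: M_def)
    have MG: "subgroup M G"
    proof (rule subgroupI)
      have "\<one> \<in> M" by (simp add: M_def)
      then show "M \<noteq> {}" by blast
      show "inv a \<in> M" if a: "a \<in> M" for a
      proof -
        have "inv (inv a) \<otimes> (inv a) \<^bold>^ x \<in> L" if x: "x \<in> P" for x
        proof -
          have aP: "a \<in> P" and l: "inv a \<otimes> a \<^bold>^ x \<in> L" using a x by (auto simp: M_def)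
          have "inv (inv a) \<otimes> (inv a) \<^bold>^ x = (inv (inv a \<otimes> a \<^bold>^ x)) \<^bold>^ (inv a)"
            using aP x by (simp add: conj_elt_def m_assoc inv_mult_group)
          also have "\<dots> \<in> L" using l aP by (intro norm) auto
          finally show ?thesis .
        qed
        then show ?thesis using a by (simp add: M_def)
      qed
      show "a \<otimes> c \<in> M" if a: "a \<in> M" and c: "c \<in> M" for a c
      proof -
        have "inv (a \<otimes> c) \<otimes> (a \<otimes> c) \<^bold>^ x \<in> L" if x: "x \<in> P" for x
        proof -
          have acP: "a \<in> P" "c \<in> P" and l: "inv a \<otimes> a \<^bold>^ x \<in> L" "inv c \<otimes> c \<^bold>^ x \<in> L"
            using a c x by (auto simp: M_def)
          have "inv (a \<otimes> c) \<otimes> (a \<otimes> c) \<^bold>^ x = (inv a \<otimes> a \<^bold>^ x) \<^bold>^ c \<otimes> (inv c \<otimes> c \<^bold>^ x)"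
            using acP x by (simp add: conj_elt_def m_assoc inv_mult_group)
          also have "\<dots> \<in> L" by (rule L.m_closed[OF norm[OF l(1) acP(2)] l(2)])
          finally show ?thesis .
        qed
        then show ?thesis using a c by (simp add: M_def)
      qed
    qed (auto simp: M_def)
    have "a \<^bold>^ x \<in> M" if a: "a \<in> M" and x: "x \<in> P" for a x
    proof -
      have aP: "a \<in> P" and "inv a \<otimes> a \<^bold>^ x \<in> L" using a x unfolding M_def by blast+
      then have "a \<otimes> (inv a \<otimes> a \<^bold>^ x) \<in> M" using subgroup.m_closed[OF MG a] LM by blast
      then show ?thesis using aP x by simp
    qed
    moreover have "a \<^bold>^ g = a" if a: "a \<in> Q" "a \<in> M" for a
    proof (rule coprime_action_trivial[OF _ g])
      obtain x where x: "x \<in> P" "a \<^bold>^ g = a \<^bold>^ x" using fus a(1) by blast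
      have "inv a \<otimes> a \<^bold>^ g \<in> L" using a(2) x by (simp add: M_def)
      then show "(inv a \<otimes> a \<^bold>^ g) \<^bold>^ g = inv a \<otimes> a \<^bold>^ g" using a(1) inv by (intro triv) auto
      show "(inv a \<otimes> a \<^bold>^ g) [^] (p ^ k) = \<one>" using k a(1) inv by simp
    qed (use a in simp)
    ultimately have "M \<in> S" unfolding S_def using MG M_def by blast
    then have "L = M" using L(2) LM by blast
    then show False using b(1) bM by blast
  qed
qed

end

section \<open>Fusion of small cyclic subgroups\<close>

context finite_group_at_prime
begin

lemma small_cyclic_subgroup:
  assumes a: "a \<in> carrier G" "a \<noteq> \<one>" "a [^] (if p = 2 then 4 else p) = \<one>"
  shows "class_subgroup (small_cyclic_class p) (generate G {a}) G"
proof -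
  have A: "subgroup (generate G {a}) G" using a by (simp add: generate_is_subgroup)
  interpret A: group "G\<lparr>carrier := generate G {a}\<rparr>" using A by (rule subgroup_imp_group)
  have aA: "a \<in> generate G {a}" by (simp add: generate.incl)
  have cyc: "cyclic_group (G\<lparr>carrier := generate G {a}\<rparr>)"
    unfolding A.cyclic_group
  proof (rule bexI[of _ a])
    have "generate G {a} = range (\<lambda>n::int. a [^] n)" unfolding generate_pow[OF a(1)] by blast
    moreover have "(\<lambda>n::int. a [^]\<^bsub>G\<lparr>carrier := generate G {a}\<rparr>\<^esub> n) = (\<lambda>n. a [^] n)"
      by (rule ext) (rule int_pow_consistent[OF A aA, symmetric])
    ultimately show "carrier (G\<lparr>carrier := generate G {a}\<rparr>) =
        range (\<lambda>n::int. a [^]\<^bsub>G\<lparr>carrier := generate G {a}\<rparr>\<^esub> n)" by simp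
  qed (use aA in simp)
  have "ord a \<noteq> 1" using a ord_eq_1 by blast
  have dvd: "ord a dvd (if p = 2 then 4 else p)" using a pow_eq_id by blast
  have "if p = 2 then ord a = 2 \<or> ord a = 4 else ord a = p"
  proof (cases "p = 2")
    case True
    then have "ord a dvd 2 ^ 2" using dvd by simp
    then obtain i where "ord a = 2 ^ i" "i \<le> 2" using divides_primepow_nat[OF two_is_prime_nat] by blast
    then show ?thesis using \<open>ord a \<noteq> 1\<close> True by (cases "i = 0"; cases "i = 1") (auto simp: le_Suc_eq numeral_2_eq_2)
  next
    case False
    then show ?thesis using dvd \<open>ord a \<noteq> 1\<close> prime_p by (auto simp: prime_nat_iff)
  qed
  then show ?thesis
    using A cyc A.is_group
    by (simp add: class_subgroup_def small_cyclic_class_def order_def generate_pow_card[OF a(1), symmetric])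
qed

text \<open>To verify Frobenius' condition for \<open>Q\<close> and \<open>g\<close>, conjugate both by an \<open>h\<close> that carries \<open>Q\<close> into \<open>P\<close>; the
  fusion hypothesis then applies to the cyclic subgroups generated by elements of the conjugate of \<open>Q\<close>.\<close>

lemma p_nilpotent_if_controls_fusion:
  assumes P: "sylow_subgroup p P G" and ctrl: "controls_fusion (small_cyclic_class p) P G"
  shows "p_nilpotent p G"
proof -
  note PG = sylow_subgroup_facts(1)[OF P] and pP = sylow_subgroup_facts(2)[OF P]
    and Pi = sylow_subgroup_facts(3)[OF P] and Pi' = sylow_subgroup_facts(4)[OF P]
  interpret P: subgroup P G by (rule PG)
  let ?e = "if p = 2 then 4 else p"
  have "p_regular_elements_centralize p G"
    unfolding p_regular_elements_centralize_def
  proof (intro allI impI ballI)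
    fix Q g a
    assume as: "p_subgroup p Q G \<and> g \<in> carrier G \<and> coprime (ord g) p \<and> (\<forall>a\<in>Q. a \<^bold>^ g \<in> Q)"
      and a: "a \<in> Q"
    have Q: "p_subgroup p Q G" and QG: "subgroup Q G" and g: "g \<in> carrier G" "coprime (ord g) p"
      and inv: "\<And>a. a \<in> Q \<Longrightarrow> a \<^bold>^ g \<in> Q"
      using as unfolding p_subgroup_def by blast+
    interpret Q: subgroup Q G by fact
    obtain h where h: "h \<in> carrier G" "\<forall>q\<in>Q. q \<^bold>^ h \<in> P"
      using sylow_conjugate[OF PG Pi' Q] by blast
    let ?Q = "(\<lambda>q. q \<^bold>^ h) ` Q" and ?g = "g \<^bold>^ h"
    have gG: "?g \<in> carrier G" using g h by simp
    have conj: "q \<^bold>^ h \<^bold>^ ?g = q \<^bold>^ g \<^bold>^ h" if "q \<in> Q" for q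
      using that g h by (simp add: conj_elt_def m_assoc inv_mult_group)
    have "\<forall>a\<in>?Q. a \<^bold>^ ?g = a"
    proof (rule p_regular_centralizes_if_small_fusion[OF pP _ _ gG])
      show "subgroup ?Q G" using QG h(1) by (rule subgroup_conj)
      show "?Q \<subseteq> P" using h(2) by blast
      show "coprime (ord ?g) p" using g h by (simp add: ord_conj)
      show inv': "a \<^bold>^ ?g \<in> ?Q" if "a \<in> ?Q" for a using that conj inv by auto
      show "\<exists>x\<in>P. a \<^bold>^ ?g = a \<^bold>^ x" if aQ: "a \<in> ?Q" and e: "a [^] ?e = \<one>" for a
      proof (cases "a = \<one>")
        case True
        then show ?thesis using gG by (intro bexI[of _ \<one>]) simp_all
      next
        case False
        have aG: "a \<in> carrier G" using aQ h(1) by auto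
        let ?A = "generate G {a}"
        have A: "class_subgroup (small_cyclic_class p) ?A G"
          using small_cyclic_subgroup[OF aG False e] .
        have AQ: "?A \<subseteq> ?Q"
          using aQ subgroup_conj[OF QG h(1)] by (intro generate_subgroup_incl) auto
        then have AP: "?A \<subseteq> P" using h(2) by blast
        have "b \<^bold>^ ?g \<in> P" if "b \<in> ?A" for b
        proof -
          have "b \<in> ?Q" using that AQ by blast
          then have "b \<^bold>^ ?g \<in> ?Q" by (rule inv')
          then show ?thesis using h(2) by auto
        qed
        then have "conj_set G ?A ?g \<subseteq> P"
          unfolding conj_set_image[OF subset_trans[OF AP P.subset] gG] by blast
        then obtain x where "x \<in> P" "\<forall>b\<in>?A. b \<^bold>^ ?g = b \<^bold>^ x"
          using ctrl A AP gG unfolding controls_fusion_def by blast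
        moreover have "a \<in> ?A" by (simp add: generate.incl)
        ultimately show ?thesis by blast
      qed
    qed
    then have "a \<^bold>^ g \<^bold>^ h = a \<^bold>^ h" using conj[OF a] a by auto
    then show "a \<^bold>^ g = a" using a g h by (simp add: conj_cancel)
  qed
  then have NG: "subgroup {x \<in> carrier G. coprime (ord x) p} G" (is "subgroup ?N G")
    using frobenius_p_nilpotency_criterion finite_group_at_prime_axioms by blast
  have normN: "x \<^bold>^ g \<in> ?N" if "x \<in> ?N" "g \<in> carrier G" for x g
    using that by (simp add: ord_conj)
  have "?N \<lhd> G"
    unfolding normal_inv_iff
  proof (intro conjI ballI NG)
    fix x n assume "x \<in> carrier G" "n \<in> ?N"
    then show "x \<otimes> n \<otimes> inv x \<in> ?N" using normN[of n "inv x"] by (simp add: conj_elt_def)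
  qed
  moreover have "carrier G = ?N <#> P"
  proof
    show "carrier G \<subseteq> ?N <#> P"
    proof
      fix x assume "x \<in> carrier G"
      then obtain c s where "c \<in> ?N" "s \<in> P" "x = c \<otimes> s"
        using factorization_over_p_regular_subgroup[OF subgroup_self NG _ PG P.subset normN, of x] Pi
        by (auto simp: order_def)
      then show "x \<in> ?N <#> P" unfolding set_mult_def by blast
    qed
    show "?N <#> P \<subseteq> carrier G" by (intro set_mult_closed) auto
  qed
  moreover have "?N \<inter> P = {\<one>}"
  proof -
    obtain k where k: "\<And>x. x \<in> P \<Longrightarrow> x [^] (p ^ k) = \<one>" using p_subgroup_pow[OF pP] by blast
    have "x = \<one>" if "x \<in> ?N" "x \<in> P" for x
      using that k ord_coprime_imp_trivial by blast
    moreover have "\<one> \<in> ?N" by simp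
    ultimately show ?thesis using P.one_closed by blast
  qed
  ultimately show ?thesis using P unfolding p_nilpotent_def by blast
qed

text \<open>The given complement \<open>N\<close> belongs to some Sylow subgroup \<open>P0\<close>; being normal, it is also a complement of the
  conjugate \<open>P\<close> of \<open>P0\<close>.\<close>

lemma controls_fusion_if_p_nilpotent:
  assumes P: "sylow_subgroup p P G" and nil: "p_nilpotent p G"
  shows "controls_fusion (small_cyclic_class p) P G"
proof -
  note PG = sylow_subgroup_facts(1)[OF P] and Pi' = sylow_subgroup_facts(4)[OF P]
  have cP: "card P = p ^ multiplicity p (order G)" using P by (simp add: sylow_subgroup_def)
  interpret P: subgroup P G by (rule PG)
  obtain P0 N where P0: "subgroup P0 G" "card P0 = p ^ multiplicity p (order G)"
    and N: "N \<lhd> G" "carrier G = N <#> P0" "N \<inter> P0 = {\<one>}"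
    using nil by (auto simp: p_nilpotent_def sylow_subgroup_def)
  have NG: "subgroup N G" using N(1) by (rule normal_imp_subgroup)
  interpret N: subgroup N G by fact
  interpret P0: subgroup P0 G by fact
  have normN: "n \<^bold>^ g \<in> N" if "n \<in> N" "g \<in> carrier G" for n g
    using that N(1) unfolding conj_elt_def by (intro normal.inv_op_closed1)
  obtain x where x: "x \<in> carrier G" "\<forall>a\<in>P0. a \<^bold>^ x \<in> P"
    using sylow_conjugate[OF PG Pi', of P0] P0 by (auto simp: p_subgroup_def)
  have P0x: "(\<lambda>a. a \<^bold>^ x) ` P0 = P"
    using x cP P0(2) PG by (intro card_subset_eq) (auto simp: subgroup_finite card_image conj_inj_on P0.subset)
  have NP: "y = \<one>" if y: "y \<in> N" "y \<in> P" for y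
  proof -
    obtain z where z: "z \<in> P0" "y = z \<^bold>^ x" using y(2) P0x by blast
    have "z = y \<^bold>^ (inv x)" using z x by simp
    then have "z \<in> N" using normN y x by simp
    then have "z = \<one>" using z N(3) by blast
    then show ?thesis using z x by simp
  qed
  have fact: "\<exists>n\<in>N. \<exists>z\<in>P. g = n \<otimes> z" if g: "g \<in> carrier G" for g
  proof -
    have "g \<^bold>^ (inv x) \<in> N <#> P0" using g x N(2) by (metis conj_closed inv_closed)
    then obtain n z where nz: "n \<in> N" "z \<in> P0" "g \<^bold>^ (inv x) = n \<otimes> z"
      unfolding set_mult_def by blast
    have "g = (g \<^bold>^ (inv x)) \<^bold>^ x" using g x by simp
    also have "\<dots> = n \<^bold>^ x \<otimes> z \<^bold>^ x" unfolding nz(3) using nz(1,2) x by (simp add: conj_mult)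
    finally show ?thesis using nz(1,2) normN x by blast
  qed
  have "\<exists>g\<in>carrier G. conj_set G A g \<subseteq> P" if A: "class_subgroup (small_cyclic_class p) A G" for A
  proof -
    have AG: "subgroup A G" using A by (simp add: class_subgroup_def)
    have "card A = 2 ^ 1 \<or> card A = 2 ^ 2 \<and> p = 2 \<or> card A = p ^ 1" "p = 2 \<or> card A = p ^ 1"
      using A by (auto simp: class_subgroup_def small_cyclic_class_def order_def split: if_splits)
    then have "\<exists>k. card A = p ^ k" by metis
    then have "p_subgroup p A G" using AG by (simp add: p_subgroup_def)
    then obtain g where "g \<in> carrier G" "\<forall>a\<in>A. a \<^bold>^ g \<in> P"
      using sylow_conjugate[OF PG Pi'] by blast
    then show ?thesis using AG conj_set_image[of A g] subgroup.subset[OF AG] by (intro bexI[of _ g]) auto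
  qed
  moreover have "\<exists>y\<in>P. \<forall>a\<in>A. a \<^bold>^ g = a \<^bold>^ y"
    if A: "A \<subseteq> P" and g: "g \<in> carrier G" "conj_set G A g \<subseteq> P" for A g
  proof -
    obtain n z where nz: "n \<in> N" "z \<in> P" "inv g = n \<otimes> z" using fact[of "inv g"] g(1) by auto
    have "g = inv (n \<otimes> z)" unfolding nz(3)[symmetric] using g(1) by simp
    then have g': "g = inv z \<otimes> inv n" using nz(1,2) by (simp add: inv_mult_group)
    have "a \<^bold>^ g = a \<^bold>^ (inv z)" if a: "a \<in> A" for a
    proof -
      let ?b = "a \<^bold>^ (inv z)"
      have aP: "a \<in> P" using a A by blast
      have bP: "?b \<in> P" using aP nz(2) by (simp add: conj_elt_def)
      have ag: "a \<^bold>^ g = ?b \<^bold>^ (inv n)" unfolding g' using aP nz(1,2) by (simp add: conj_conj)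
      have "a \<^bold>^ g \<in> P" using a g A conj_set_image[of A g] P.subset by blast
      then have "inv ?b \<otimes> ?b \<^bold>^ (inv n) \<in> P" using bP by (simp add: ag)
      (* The commutator of b and the inverse of n lies in P, and by normality also in N. *)
      moreover have "inv ?b \<otimes> ?b \<^bold>^ (inv n) = n \<^bold>^ ?b \<otimes> inv n"
        using bP nz(1) by (simp add: conj_elt_def m_assoc)
      then have "inv ?b \<otimes> ?b \<^bold>^ (inv n) \<in> N" using normN[of n ?b] nz(1) bP by simp
      ultimately have "inv ?b \<otimes> ?b \<^bold>^ (inv n) = \<one>" by (intro NP)
      then have "?b \<otimes> (inv ?b \<otimes> ?b \<^bold>^ (inv n)) = ?b" using bP by simp
      then show ?thesis using bP nz(1) ag by simp
    qed
    then show ?thesis using nz(2) by blast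
  qed
  ultimately show ?thesis using PG unfolding controls_fusion_def by blast
qed

end

theorem theoremB:
  fixes G :: "('a, 'b) monoid_scheme" and P :: "'a set" and p :: nat
  assumes "Factorial_Ring.prime p"
    and "group G"
    and "finite (carrier G)"
    and "sylow_subgroup p P G"
  shows "p_nilpotent p G \<longleftrightarrow> controls_fusion (small_cyclic_class p) P G"
proof -
  interpret finite_group_at_prime G p
    using assms by (simp add: finite_group_at_prime_def finite_group_at_prime_axioms_def)
  show ?thesis
    using controls_fusion_if_p_nilpotent p_nilpotent_if_controls_fusion assms(4) by blast
qed

end
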